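(* Assume the continuum hypothesis. If $L$ is a nonseparable linearly ordered compact space, then there is a nontrivial twisted sum of $c_0$ and $C(L)$.
   Context: A linearly ordered compact space is a compact space whose topology is the order topology of some linear order. $C(L)$ is the Banach space of continuous real-valued functions on $L$. A twisted sum of Banach spaces $Z$ and $Y$ is a short exact sequence $0\to Z\to X\to Y\to 0$ with $X$ a Banach space and the maps bounded linear operators; it is trivial if it splits (the map $Z\to X$ has a bounded linear left inverse; equivalently, its range is complemented in $X$), and nontrivial otherwise. *)

theory Defs
  imports "HOL-Analysis.Analysis" "HOL-Library.Equipollence"
begin

definition continuum_hypothesis :: bool where
  "continuum_hypothesis \<longleftrightarrow>
    (\<forall>A :: real set. infinite A \<longrightarrow> A \<approx> (UNIV :: nat set) \<or> A \<approx> (UNIV :: real set))"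

text \<open>
  A Banach space is given by a linear subspace \<open>X\<close> of an ambient real vector space together with a
  complete norm \<open>N\<close> on \<open>X\<close>. Only the vector space structure of the ambient type is used, not any
  norm it may carry; the values of \<open>N\<close> outside \<open>X\<close> are irrelevant.
\<close>

definition norm_on :: "'v::real_vector set \<Rightarrow> ('v \<Rightarrow> real) \<Rightarrow> bool" where
  "norm_on X N \<longleftrightarrow>
    (\<forall>x\<in>X. 0 \<le> N x) \<and>
    (\<forall>x\<in>X. N x = 0 \<longleftrightarrow> x = 0) \<and>
    (\<forall>x\<in>X. \<forall>c. N (c *\<^sub>R x) = \<bar>c\<bar> * N x) \<and>
    (\<forall>x\<in>X. \<forall>y\<in>X. N (x + y) \<le> N x + N y)"

definition complete_norm_on :: "'v::real_vector set \<Rightarrow> ('v \<Rightarrow> real) \<Rightarrow> bool" where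
  "complete_norm_on X N \<longleftrightarrow>
    (\<forall>s :: nat \<Rightarrow> 'v. range s \<subseteq> X \<and>
        (\<forall>e>0. \<exists>k. \<forall>m\<ge>k. \<forall>n\<ge>k. N (s m - s n) < e) \<longrightarrow>
        (\<exists>x\<in>X. (\<lambda>n. N (s n - x)) \<longlonglongrightarrow> 0))"

definition banach_on :: "'v::real_vector set \<Rightarrow> ('v \<Rightarrow> real) \<Rightarrow> bool" where
  "banach_on X N \<longleftrightarrow> subspace X \<and> norm_on X N \<and> complete_norm_on X N"

definition bounded_linear_on ::
    "'v::real_vector set \<Rightarrow> ('v \<Rightarrow> real) \<Rightarrow> 'w::real_vector set \<Rightarrow> ('w \<Rightarrow> real) \<Rightarrow> ('v \<Rightarrow> 'w) \<Rightarrow> bool" where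
  "bounded_linear_on X N Y M f \<longleftrightarrow>
    f ` X \<subseteq> Y \<and>
    (\<forall>x\<in>X. \<forall>y\<in>X. f (x + y) = f x + f y) \<and>
    (\<forall>x\<in>X. \<forall>c. f (c *\<^sub>R x) = c *\<^sub>R f x) \<and>
    (\<exists>K. \<forall>x\<in>X. M (f x) \<le> K * N x)"

text \<open>The short exact sequence \<open>0 \<rightarrow> Z \<rightarrow> X \<rightarrow> Y \<rightarrow> 0\<close> with maps \<open>i\<close> and \<open>q\<close>.\<close>

definition twisted_sum ::
    "'z::real_vector set \<Rightarrow> ('z \<Rightarrow> real) \<Rightarrow> 'y::real_vector set \<Rightarrow> ('y \<Rightarrow> real) \<Rightarrow>
     'x::real_vector set \<Rightarrow> ('x \<Rightarrow> real) \<Rightarrow> ('z \<Rightarrow> 'x) \<Rightarrow> ('x \<Rightarrow> 'y) \<Rightarrow> bool" where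
  "twisted_sum Z NZ Y NY X NX i q \<longleftrightarrow>
    banach_on Z NZ \<and> banach_on Y NY \<and> banach_on X NX \<and>
    bounded_linear_on Z NZ X NX i \<and> bounded_linear_on X NX Y NY q \<and>
    inj_on i Z \<and> i ` Z = {x \<in> X. q x = 0} \<and> q ` X = Y"

definition trivial_twisted_sum ::
    "'z::real_vector set \<Rightarrow> ('z \<Rightarrow> real) \<Rightarrow> 'x::real_vector set \<Rightarrow> ('x \<Rightarrow> real) \<Rightarrow> ('z \<Rightarrow> 'x) \<Rightarrow> bool" where
  "trivial_twisted_sum Z NZ X NX i \<longleftrightarrow>
    (\<exists>r. bounded_linear_on X NX Z NZ r \<and> (\<forall>z\<in>Z. r (i z) = z))"

text \<open>
  As \<open>nat\<close> is discrete, \<open>nat \<Rightarrow>\<^sub>C real\<close> is the space of bounded sequences with the supremum norm, so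
  the norm of the ambient type restricts to the usual norm of \<open>c\<^sub>0\<close>. Likewise, for a compact type
  \<open>'l\<close>, the type \<open>'l \<Rightarrow>\<^sub>C real\<close> with its norm is the Banach space \<open>C(L)\<close>, boundedness being automatic.
\<close>

definition c0 :: "(nat \<Rightarrow>\<^sub>C real) set" where
  "c0 = {f. apply_bcontfun f \<longlonglongrightarrow> 0}"

text \<open>
  To assert that a twisted sum of \<open>c\<^sub>0\<close> and \<open>C(L)\<close> exists, one can take the ambient vector space of
  the middle term to be \<open>(nat \<Rightarrow>\<^sub>C real) \<times> ('l \<Rightarrow>\<^sub>C real)\<close>. This loses nothing: every exact sequence of
  vector spaces splits algebraically, so the middle term of any such twisted sum is linearly
  isomorphic to \<open>c\<^sub>0 \<times> C(L)\<close>, and its norm can be transported along the isomorphism.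
\<close>

end

theory Submission
  imports Defs
begin

text \<open>
  The proof pulls the canonical extension \<open>0 \<rightarrow> c\<^sub>0 \<rightarrow> \<ell>\<^sub>\<infinity> \<rightarrow> \<ell>\<^sub>\<infinity>/c\<^sub>0 \<rightarrow> 0\<close> back along an operator
  \<open>C(L) \<rightarrow> \<ell>\<^sub>\<infinity>/c\<^sub>0\<close>. The pullback splits exactly if the operator lifts to a bounded operator into
  \<open>\<ell>\<^sub>\<infinity>\<close>, so it suffices to find an operator without such a lifting.

  The operator is composition with a continuous map from \<open>\<beta>\<nat> - \<nat>\<close> to \<open>L\<close>. Let \<open>A x\<close>, for
  \<open>x \<in> L\<close>, be sets of natural numbers that increase with \<open>x\<close> modulo finite sets. Sending a free
  ultrafilter \<open>p\<close> to the infimum of \<open>{x. A x \<in> p}\<close> is continuous, and the fibre over \<open>z\<close> is the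
  closed set of ultrafilters that refine one filter, \<open>cut_filter A z\<close>. In these terms the pullback is
  the set \<open>pullback_space A\<close> of all pairs \<open>(u, f)\<close> such that \<open>u\<close> tends to \<open>f z\<close> along
  \<open>cut_filter A z\<close> for every \<open>z\<close>, and no ultrafilter has to be mentioned. Compactness of \<open>L\<close> yields
  exactness: these filters together cover the cofinite filter (\<open>cut_filters_cover\<close>), so the kernel of
  \<open>(u, f) \<mapsto> f\<close> is \<open>c\<^sub>0\<close>; and a continuous \<open>f\<close> is determined up to \<open>\<epsilon>\<close> by the position relative to
  finitely many points, which lets one build \<open>u\<close> from \<open>f\<close> (\<open>pullback_space_surj\<close>).

  A splitting gives countably many bounded functionals \<open>\<mu> n\<close> on \<open>C(L)\<close> with \<open>\<mu> n f\<close> tending to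
  \<open>f z\<close> along \<open>cut_filter A z\<close>. On a linearly ordered compact space a bounded functional is carried by
  a countable set (\<open>functional_countably_carried\<close>). Hence a function supported by an interval that
  misses all those countable sets is killed by every \<open>\<mu> n\<close>, and must vanish at each point whose filter
  is proper. This is absurd if the set \<open>D\<close> of these points does not lie in the closure of a
  countable set (\<open>pullback_space_nontrivial\<close>).

  It remains to find \<open>D\<close> and \<open>A\<close>. As \<open>L\<close> is nonseparable, there is a sequence of length
  \<open>\<omega>\<^sub>1\<close> none of whose members lies in the closure of the earlier ones. Its range \<open>D\<close> is not
  contained in the closure of any countable set, because separability is hereditary in linearly
  ordered spaces. The filter of a point of \<open>D\<close> is proper if \<open>A\<close> jumps by an infinite set there, and it
  is enough to index \<open>A\<close> by the sets \<open>D \<inter> {..p}\<close>. The sequence can be chosen so that at most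
  continuum many sets of this form exist (\<open>left_separated_sequence\<close>, \<open>cuts_lepoll_real\<close>). Under the
  continuum hypothesis they can be enumerated so that only countably many precede each, and
  then the fact that \<open>\<P>(\<nat>)\<close> modulo finite sets has no countable gaps
  (\<open>almost_below_insertion\<close>) allows a recursive choice of \<open>A\<close>.
\<close>

section \<open>The order type of the continuum under the continuum hypothesis\<close>

text \<open>
  A well-order of minimal type on the reals has initial segments of size less than the continuum,
  which the hypothesis forces to be countable.
\<close>

lemma CH_well_order:
  assumes continuum_hypothesis
  obtains R :: "real rel" where "wf R" "total R" "\<And>a. countable {b. (b, a) \<in> R}"
proof -
  let ?r = "card_of (UNIV :: real set)"
  have wo: "Well_order ?r" and fld: "Field ?r = UNIV"
    by (rule card_of_Well_order, rule Field_card_of)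
  have "countable {b. (b, a) \<in> ?r - Id}" for a
  proof -
    have us: "{b. (b, a) \<in> ?r - Id} = underS ?r a"
      by (auto simp: underS_def)
    have "(card_of (underS ?r a), ?r) \<in> ordLess"
      by (rule card_of_underS[OF card_of_Card_order]) (simp add: fld)
    then have "(?r, card_of (underS ?r a)) \<notin> ordLeq"
      by (rule not_ordLess_ordLeq)
    then have less: "\<not> (UNIV :: real set) \<lesssim> underS ?r a"
      by (simp add: lepoll_def card_of_ordLeq)
    show ?thesis
    proof (cases "finite (underS ?r a)")
      case False
      then have "underS ?r a \<approx> (UNIV :: nat set)"
        using assms less eqpoll_imp_lepoll eqpoll_sym unfolding continuum_hypothesis_def by blast
      then show ?thesis
        using us eqpoll_imp_lepoll countable_lepoll by (metis countableI_type)
    qed (simp only: us countable_finite)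
  qed
  moreover have "wf (?r - Id)"
    using wo by (simp add: well_order_on_def)
  moreover have "total (?r - Id)"
    using wo fld by (auto simp: well_order_on_def linear_order_on_def total_on_def)
  ultimately show thesis
    by (rule_tac that)
qed

text \<open>Uncountable cofinality of \<open>\<omega>\<^sub>1\<close>.\<close>

lemma countable_imp_bounded:
  fixes R :: "real rel"
  assumes "total R" "\<And>a. countable {b. (b, a) \<in> R}" "countable B"
  shows "\<exists>a. \<forall>b\<in>B. (b, a) \<in> R"
proof -
  have "countable (\<Union>b\<in>B. insert b {c. (c, b) \<in> R})"
    by (intro countable_UN countable_insert assms)
  then have "(\<Union>b\<in>B. insert b {c. (c, b) \<in> R}) \<noteq> UNIV"
    using uncountable_UNIV_real by auto
  then obtain a where a: "a \<notin> (\<Union>b\<in>B. insert b {c. (c, b) \<in> R})"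
    by blast
  have "(b, a) \<in> R" if "b \<in> B" for b
    using a that \<open>total R\<close> unfolding total_on_def by blast
  then show ?thesis
    by blast
qed

lemma real_sequences_lepoll_real: "(UNIV :: (nat \<Rightarrow> real) set) \<lesssim> (UNIV :: real set)"
proof -
  obtain g :: "real \<Rightarrow> nat set" where g: "inj g"
    using nat_sets_eqpoll_reals eqpoll_sym unfolding eqpoll_def bij_betw_def by blast
  let ?c = "\<lambda>s :: nat \<Rightarrow> real. {prod_encode (n, m) |n m. m \<in> g (s n)}"
  have "inj ?c"
  proof (rule injI, rule ext)
    fix s t n
    assume "?c s = ?c t"
    then have "prod_encode (n, m) \<in> ?c s \<longleftrightarrow> prod_encode (n, m) \<in> ?c t" for m
      by simp
    then have "g (s n) = g (t n)"
      by auto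
    then show "s n = t n"
      using g by (simp add: inj_eq)
  qed
  then have "(UNIV :: (nat \<Rightarrow> real) set) \<lesssim> (UNIV :: nat set set)"
    unfolding lepoll_def by blast
  then show ?thesis
    using nat_sets_eqpoll_reals eqpoll_imp_lepoll lepoll_trans by blast
qed

section \<open>Separability in linearly ordered spaces\<close>

text \<open>
  The finite set \<open>S\<close> holds the left end of the interval \<open>J\<close> if it has one: a point below \<open>J\<close> is
  separated from every point of \<open>J\<close> by that end.
\<close>

lemma interval_neighbourhood:
  fixes z :: "'l :: linorder_topology"
  assumes T: "open T" "z \<in> T"
  obtains J S where "open J" "z \<in> J" "J \<subseteq> T" "\<forall>a\<in>J. \<forall>b\<in>J. {a..b} \<subseteq> J"
    "finite S" "\<forall>y\<in>J. \<forall>x<y. {x..<y} \<inter> S = {} \<longrightarrow> x \<in> J"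
proof -
  have "\<exists>U S. open U \<and> z \<in> U \<and> {..z} \<inter> U \<subseteq> T \<and> (\<forall>a\<in>U. \<forall>b\<ge>a. b \<in> U) \<and> finite S \<and>
           (\<forall>y\<in>U. \<forall>x<y. {x..<y} \<inter> S = {} \<longrightarrow> x \<in> U)"
  proof (cases "\<exists>w. w < z")
    case True
    then obtain a where "a < z" "{a<..z} \<subseteq> T"
      using open_left[OF T] by blast
    then show ?thesis
      by (intro exI[of _ "{a<..}"] exI[of _ "{a}"]) (auto simp: not_less)
  next
    case False
    then have "{..z} = {z}"
      by (auto simp: not_less order.antisym)
    then show ?thesis
      using T by (intro exI[of _ UNIV] exI[of _ "{}"]) auto
  qed
  then obtain U S where U: "open U" "z \<in> U" "{..z} \<inter> U \<subseteq> T" "\<forall>a\<in>U. \<forall>b\<ge>a. b \<in> U" "finite S"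
      "\<forall>y\<in>U. \<forall>x<y. {x..<y} \<inter> S = {} \<longrightarrow> x \<in> U"
    by (elim exE conjE)
  have "\<exists>V. open V \<and> z \<in> V \<and> {z..} \<inter> V \<subseteq> T \<and> (\<forall>b\<in>V. \<forall>a\<le>b. a \<in> V)"
  proof (cases "\<exists>w. z < w")
    case True
    then obtain b where "z < b" "{z..<b} \<subseteq> T"
      using open_right[OF T] by blast
    then show ?thesis
      by (intro exI[of _ "{..<b}"]) auto
  next
    case False
    then have "{z..} = {z}"
      by (auto simp: not_less order.antisym)
    then show ?thesis
      using T by (intro exI[of _ UNIV]) auto
  qed
  then obtain V where V: "open V" "z \<in> V" "{z..} \<inter> V \<subseteq> T" "\<forall>b\<in>V. \<forall>a\<le>b. a \<in> V"
    by (elim exE conjE)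
  show thesis
  proof (rule that[of "U \<inter> V" S])
    show "U \<inter> V \<subseteq> T"
    proof
      fix v assume "v \<in> U \<inter> V"
      then show "v \<in> T"
        using U(3) V(3) linear[of v z] by blast
    qed
    show "\<forall>a\<in>U \<inter> V. \<forall>b\<in>U \<inter> V. {a..b} \<subseteq> U \<inter> V"
      using U(4) V(4) by fastforce
    show "\<forall>y\<in>U \<inter> V. \<forall>x<y. {x..<y} \<inter> S = {} \<longrightarrow> x \<in> U \<inter> V"
      using U(6) V(4) by (meson IntD1 IntD2 IntI less_imp_le)
  qed (use U(1,2,5) V(1,2) in auto)
qed

text \<open>
  Choosing a point of \<open>D\<close> between any two points of \<open>E\<close> is not enough, because \<open>D\<close> may have isolated
  points. If \<open>e\<close> is close to an isolated point \<open>d\<close> of \<open>D\<close>, however, then \<open>d\<close> is the next element of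
  \<open>D\<close> after or before \<open>e\<close>, so these neighbours of the points of \<open>E\<close> are chosen as well.
\<close>

lemma hereditarily_separable:
  fixes D E :: "'l :: linorder_topology set"
  assumes E: "countable E" and DE: "D \<subseteq> closure E"
  shows "\<exists>C\<subseteq>D. countable C \<and> D \<subseteq> closure C"
proof -
  define p where "p = (\<lambda>e e'. SOME d. d \<in> D \<and> e \<le> d \<and> d \<le> e')"
  define lo where "lo = (\<lambda>e. SOME d. d \<in> D \<and> e \<le> d \<and> (\<forall>d'\<in>D. e \<le> d' \<longrightarrow> d \<le> d'))"
  define hi where "hi = (\<lambda>e. SOME d. d \<in> D \<and> d \<le> e \<and> (\<forall>d'\<in>D. d' \<le> e \<longrightarrow> d' \<le> d))"
  define C where "C = D \<inter> ((\<lambda>(e, e'). p e e') ` (E \<times> E) \<union> lo ` E \<union> hi ` E)"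
  have p: "p e e' \<in> C \<and> e \<le> p e e' \<and> p e e' \<le> e'"
    if "e \<in> E" "e' \<in> E" "d \<in> D" "e \<le> d" "d \<le> e'" for e e' d
    using someI[of "\<lambda>d. d \<in> D \<and> e \<le> d \<and> d \<le> e'" d] that unfolding p_def C_def by force
  have lo: "lo e \<in> C \<and> e \<le> lo e \<and> (\<forall>d'\<in>D. e \<le> d' \<longrightarrow> lo e \<le> d')"
    if "e \<in> E" "d \<in> D" "e \<le> d" "\<And>d'. d' \<in> D \<Longrightarrow> e \<le> d' \<Longrightarrow> d \<le> d'" for e d
    using someI[of "\<lambda>d. d \<in> D \<and> e \<le> d \<and> (\<forall>d'\<in>D. e \<le> d' \<longrightarrow> d \<le> d')" d] that
    unfolding lo_def C_def by auto
  have hi: "hi e \<in> C \<and> hi e \<le> e \<and> (\<forall>d'\<in>D. d' \<le> e \<longrightarrow> d' \<le> hi e)"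
    if "e \<in> E" "d \<in> D" "d \<le> e" "\<And>d'. d' \<in> D \<Longrightarrow> d' \<le> e \<Longrightarrow> d' \<le> d" for e d
    using someI[of "\<lambda>d. d \<in> D \<and> d \<le> e \<and> (\<forall>d'\<in>D. d' \<le> e \<longrightarrow> d' \<le> d)" d] that
    unfolding hi_def C_def by auto
  have meets: "\<exists>e\<in>E. e \<in> T" if "d \<in> D" "d \<in> T" "open T" for d T
    using DE that closure_iff_nhds_not_empty[of d E] by blast
  have "d \<in> closure C" if d: "d \<in> D" for d
  proof -
    have "\<exists>c\<in>C. c \<in> T" if T: "open T" "d \<in> T" for T
    proof -
      obtain J where J: "open J" "d \<in> J" "J \<subseteq> T" and conv: "\<forall>a\<in>J. \<forall>b\<in>J. {a..b} \<subseteq> J"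
        using interval_neighbourhood[OF T] by metis
      obtain e where e: "e \<in> E" "e \<in> J"
        using meets d J by blast
      consider "e \<le> d" | "d \<le> e"
        by fastforce
      then show ?thesis
      proof cases
        case 1
        show ?thesis
        proof (cases "\<exists>m\<in>D. e \<le> m \<and> (\<forall>d'\<in>D. e \<le> d' \<longrightarrow> m \<le> d')")
          case True
          then have "lo e \<in> C \<and> e \<le> lo e \<and> lo e \<le> d"
            using lo e 1 d by blast
          then show ?thesis
            using bspec[OF bspec[OF conv] , OF e(2) J(2)] J(3) by force
        next
          case False
          \<comment> \<open>Without a next element, \<open>D\<close> has infinitely many points between \<open>e\<close> and \<open>d\<close>, so a second
            point of \<open>E\<close> lies there.\<close>
          then have step: "\<exists>d''\<in>D. e \<le> d'' \<and> d'' < d'" if "d' \<in> D" "e \<le> d'" for d'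
            using that by (meson not_le)
          obtain d1 d2 d3 where "d1 \<in> D" "d2 \<in> D" "d3 \<in> D" "e \<le> d3" "d3 < d2" "d2 < d1" "d1 < d"
            using step[OF d 1] step by blast
          moreover then obtain e' where "e' \<in> E" "d3 < e'" "e' < d1"
            using meets[of d2 "{d3<..<d1}"] by auto
          ultimately have "p e e' \<in> C" "e \<le> p e e'" "p e e' \<le> d"
            using p[of e e' d3] e by force+
          then show ?thesis
            using bspec[OF bspec[OF conv] , OF e(2) J(2)] J(3) by force
        qed
      next
        case 2
        show ?thesis
        proof (cases "\<exists>m\<in>D. m \<le> e \<and> (\<forall>d'\<in>D. d' \<le> e \<longrightarrow> d' \<le> m)")
          case True
          then have "hi e \<in> C \<and> hi e \<le> e \<and> d \<le> hi e"
            using hi e 2 d by blast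
          then show ?thesis
            using bspec[OF bspec[OF conv] , OF J(2) e(2)] J(3) by force
        next
          case False
          then have step: "\<exists>d''\<in>D. d'' \<le> e \<and> d' < d''" if "d' \<in> D" "d' \<le> e" for d'
            using that by (meson not_le)
          obtain d1 d2 d3 where "d1 \<in> D" "d2 \<in> D" "d3 \<in> D" "d3 \<le> e" "d2 < d3" "d1 < d2" "d < d1"
            using step[OF d 2] step by blast
          moreover then obtain e' where "e' \<in> E" "d1 < e'" "e' < d3"
            using meets[of d2 "{d1<..<d3}"] by auto
          ultimately have "p e' e \<in> C" "d \<le> p e' e" "p e' e \<le> e"
            using p[of e' e d3] e by force+
          then show ?thesis
            using bspec[OF bspec[OF conv] , OF J(2) e(2)] J(3) by force
        qed
      qed
    qed
    then show ?thesis
      by (auto simp: closure_iff_nhds_not_empty)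
  qed
  moreover have "countable C"
    using E unfolding C_def by (intro countable_Int2 countable_Un countable_image countable_SIGMA) auto
  ultimately show ?thesis
    unfolding C_def by blast
qed

text \<open>
  The second property bounds the number of cuts of the sequence. It is automatic if every subset of
  the space has a countable cofinal subset. Otherwise the sequence is taken increasing inside a set
  \<open>U\<close> without countable cofinal subset; then a cut other than the whole range is an initial segment of
  the sequence, hence countable.
\<close>

lemma left_separated_sequence:
  fixes R :: "real rel"
  assumes wf: "wf R" and R: "total R" "\<And>a. countable {b. (b, a) \<in> R}"
    and nonsep: "\<not> separable_space (euclidean :: 'l::linorder_topology topology)"
  obtains x :: "real \<Rightarrow> 'l::linorder_topology" where
    "\<And>a. x a \<notin> closure (x ` {b. (b, a) \<in> R})"
    "\<And>p. range x \<inter> {..p} = range x \<or>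
          (\<exists>C\<subseteq>range x \<inter> {..p}. countable C \<and> (\<forall>d\<in>range x \<inter> {..p}. \<exists>c\<in>C. d \<le> c))"
proof (cases "\<forall>U :: 'l set. \<exists>C\<subseteq>U. countable C \<and> (\<forall>u\<in>U. \<exists>c\<in>C. u \<le> c)")
  case True
  have "\<exists>x. \<forall>a. x a \<notin> closure (x ` {b. (b, a) \<in> R} :: 'l set)"
  proof (rule dependent_wf_choice[OF wf, where P = "\<lambda>x a v. v \<notin> closure (x ` {b. (b, a) \<in> R})"])
    fix a and x :: "real \<Rightarrow> 'l"
    have "countable (x ` {b. (b, a) \<in> R})"
      using R(2) by blast
    then show "\<exists>v. v \<notin> closure (x ` {b. (b, a) \<in> R})"
      using nonsep unfolding separable_space_def by (auto simp: Set.set_eq_iff)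
  next
    fix f g :: "real \<Rightarrow> 'l" and a v
    assume "\<And>b. (b, a) \<in> R \<Longrightarrow> f b = g b"
    then have "f ` {b. (b, a) \<in> R} = g ` {b. (b, a) \<in> R}"
      by (intro image_cong) auto
    then show "(v \<notin> closure (f ` {b. (b, a) \<in> R})) = (v \<notin> closure (g ` {b. (b, a) \<in> R}))"
      by simp
  qed
  then show thesis
    using that True by blast
next
  case False
  then obtain U :: "'l set" where U: "\<And>C. C \<subseteq> U \<Longrightarrow> countable C \<Longrightarrow> \<exists>u\<in>U. \<forall>c\<in>C. c < u"
    by (metis not_le)
  \<comment> \<open>The intermediate \<open>u\<close> keeps the new member away from the closure of the earlier ones.\<close>
  define P where "P = (\<lambda>x a v. v \<in> U \<and> (\<exists>u\<in>U. u < v \<and> (\<forall>b. (b, a) \<in> R \<longrightarrow> x b < u)))"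
  have "\<exists>x. \<forall>a. P x a (x a)"
  proof (rule dependent_wf_choice[OF wf])
    fix a and x :: "real \<Rightarrow> 'l"
    assume "\<And>b. (b, a) \<in> R \<Longrightarrow> P x b (x b)"
    then have "x ` {b. (b, a) \<in> R} \<subseteq> U" "countable (x ` {b. (b, a) \<in> R})"
      using R(2) by (auto simp: P_def)
    from U[OF this] obtain u where "u \<in> U" "\<forall>b. (b, a) \<in> R \<longrightarrow> x b < u"
      by auto
    moreover then obtain v where "v \<in> U" "u < v"
      using U[of "{u}"] by auto
    ultimately show "\<exists>v. P x a v"
      unfolding P_def by blast
  qed (auto simp: P_def)
  then obtain x where x: "\<And>a. P x a (x a)"
    by blast
  have mono: "x b < x a" if "(b, a) \<in> R" for a b
    using x[of a] that unfolding P_def by force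
  have "x a \<notin> closure (x ` {b. (b, a) \<in> R})" for a
  proof -
    obtain u where "u < x a" "\<forall>b. (b, a) \<in> R \<longrightarrow> x b < u"
      using x[of a] unfolding P_def by blast
    then have "x a \<in> {u<..}" "{u<..} \<inter> x ` {b. (b, a) \<in> R} = {}"
      by auto
    then show ?thesis
      by (metis closure_iff_nhds_not_empty open_greaterThan subset_refl inf_commute)
  qed
  moreover have "\<exists>C\<subseteq>range x \<inter> {..p}. countable C \<and> (\<forall>d\<in>range x \<inter> {..p}. \<exists>c\<in>C. d \<le> c)"
    if p: "range x \<inter> {..p} \<noteq> range x" for p
  proof -
    obtain a where "\<not> x a \<le> p"
      using p by blast
    then have "p < x a"
      by simp
    then have "range x \<inter> {..p} \<subseteq> x ` {b. (b, a) \<in> R}"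
    proof -
      have "(b, a) \<in> R" if "x b \<le> p" for b
        using that \<open>p < x a\<close> mono[of a b] \<open>total R\<close> unfolding total_on_def
        by (metis UNIV_I leD less_trans)
      then show ?thesis
        by auto
    qed
    then have "countable (range x \<inter> {..p})"
      using R(2) countable_subset countable_image by metis
    then show ?thesis
      by blast
  qed
  ultimately show thesis
    using that by metis
qed

section \<open>Chains of sets of natural numbers modulo finite sets\<close>

definition almost_below :: "'a set \<Rightarrow> 'a set \<Rightarrow> bool" where
  "almost_below U V \<longleftrightarrow> finite (U - V) \<and> infinite (V - U)"

lemma strict_selector:
  fixes S :: "nat \<Rightarrow> nat set"
  assumes "\<And>n. infinite (S n)"
  obtains s where "strict_mono s" "\<And>n. s n \<in> S n"
proof -
  have "\<exists>s. \<forall>n. s n \<in> S n \<and> s n < s (Suc n)"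
  proof (rule dependent_nat_choice)
    show "\<exists>m. m \<in> S 0"
      using infinite_imp_nonempty[OF assms[of 0]] by blast
    show "\<exists>m'. m' \<in> S (Suc n) \<and> m < m'" if "m \<in> S n" for m n
      using assms[of "Suc n"] by (metis infinite_nat_iff_unbounded)
  qed
  then show thesis
    using that by (metis strict_mono_Suc_iff)
qed

text \<open>
  Enumerate \<open>B\<close> by \<open>e\<close>, and let \<open>P n\<close> and \<open>Q n\<close> be the union of the lower and the intersection of the
  upper sets with index at most \<open>n\<close>. The union of all \<open>A b \<inter> Q (e b)\<close> over the lower \<open>b\<close> fills the
  gap: it contains each lower set up to finitely many elements, and exceeds the upper set with
  index \<open>n\<close> only by what lower sets with index below \<open>n\<close> contribute. For strictness,
  pick distinct \<open>s n \<in> Q n - P n\<close>, put those with even \<open>n\<close> in and leave those with odd \<open>n\<close> out.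
  The bounds \<open>{}\<close> and \<open>UNIV\<close> keep the gaps infinite when there is no lower or no upper set.
\<close>

lemma almost_below_insertion:
  fixes A :: "'a::linorder \<Rightarrow> nat set"
  assumes B: "countable B"
    and A: "\<And>b c. b \<in> B \<Longrightarrow> c \<in> B \<Longrightarrow> b < c \<Longrightarrow> almost_below (A b) (A c)"
    and ends: "\<And>b. b \<in> B \<Longrightarrow> almost_below {} (A b) \<and> almost_below (A b) UNIV"
  shows "\<exists>V. almost_below {} V \<and> almost_below V UNIV \<and>
           (\<forall>b\<in>B. (b < g \<longrightarrow> almost_below (A b) V) \<and> (g < b \<longrightarrow> almost_below V (A b)))"
proof -
  obtain e :: "'a \<Rightarrow> nat" where e: "inj_on e B"
    using B by (rule countableE)
  define L where "L = (\<lambda>n. {b \<in> B. b < g \<and> e b \<le> n})"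
  define H where "H = (\<lambda>n. {b \<in> B. g < b \<and> e b \<le> n})"
  define P where "P = (\<lambda>n. \<Union>b\<in>L n. A b)"
  define Q where "Q = (\<lambda>n. \<Inter>b\<in>H n. A b)"
  have "finite {b \<in> B. e b \<le> n}" for n
    by (rule inj_on_finite[where f = e and B = "{..n}"]) (use e in \<open>auto simp: inj_on_def\<close>)
  then have fin: "finite (L n)" "finite (H n)" for n
    by (auto simp: L_def H_def intro: rev_finite_subset)
  have below: "finite (A b - A c)" if "b \<in> B" "c \<in> B" "b \<le> c" for b c
    using A[OF that(1,2)] that(3) by (cases "b = c") (auto simp: almost_below_def)
  have gap: "infinite (Q n - P n)" for n
  proof -
    define l where "l = (if L n = {} then {} else A (Max (L n)))"
    define h where "h = (if H n = {} then UNIV else A (Min (H n)))"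
    have Lmax: "Max (L n) \<in> B" "Max (L n) < g" if "L n \<noteq> {}"
      using Max_in[OF fin(1) that] by (auto simp: L_def)
    have Hmin: "Min (H n) \<in> B" "g < Min (H n)" if "H n \<noteq> {}"
      using Min_in[OF fin(2) that] by (auto simp: H_def)
    have "almost_below l h"
    proof (cases "L n = {} \<or> H n = {}")
      case True
      then show ?thesis
        using ends Lmax Hmin by (auto simp: l_def h_def almost_below_def[of "{}" UNIV])
    next
      case False
      then have "Max (L n) < Min (H n)"
        using Lmax Hmin by (meson less_trans)
      then show ?thesis
        using A Lmax Hmin False by (simp add: l_def h_def)
    qed
    then have inf: "infinite (h - l)"
      by (simp add: almost_below_def)
    have "P n - l \<subseteq> (\<Union>b\<in>L n. A b - A (Max (L n)))"
      by (auto simp: P_def l_def split: if_splits)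
    moreover have "finite (\<Union>b\<in>L n. A b - A (Max (L n)))"
    proof (rule finite_UN_I[OF fin(1)])
      fix b assume b: "b \<in> L n"
      then show "finite (A b - A (Max (L n)))"
        using below[of b "Max (L n)"] Lmax Max_ge[OF fin(1) b] by (auto simp: L_def)
    qed
    ultimately have "finite (P n - l)"
      by (rule finite_subset)
    moreover have "h - Q n \<subseteq> (\<Union>b\<in>H n. A (Min (H n)) - A b)"
      by (auto simp: Q_def h_def split: if_splits)
    moreover have "finite (\<Union>b\<in>H n. A (Min (H n)) - A b)"
    proof (rule finite_UN_I[OF fin(2)])
      fix b assume b: "b \<in> H n"
      then show "finite (A (Min (H n)) - A b)"
        using below[of "Min (H n)" b] Hmin Min_le[OF fin(2) b] by (auto simp: H_def)
    qed
    ultimately have "finite ((P n - l) \<union> (h - Q n))"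
      by (blast intro: finite_UnI finite_subset)
    moreover have "h - l \<subseteq> (Q n - P n) \<union> ((P n - l) \<union> (h - Q n))"
      by blast
    ultimately show ?thesis
      using inf by (meson finite_UnI finite_subset)
  qed
  obtain s where s: "strict_mono s" "\<And>n. s n \<in> Q n - P n"
    using strict_selector[of "\<lambda>n. Q n - P n"] gap by blast
  have inj: "inj s"
    using s(1) by (rule strict_mono_imp_inj_on)
  have tail: "infinite (s ` {j. k \<le> j \<and> even j})" "infinite (s ` {j. k \<le> j \<and> odd j})" for k
  proof -
    have "infinite {j. k \<le> j \<and> even j}" "infinite {j. k \<le> j \<and> odd j}"
      unfolding infinite_nat_iff_unbounded_le
      by (rule allI, rule_tac x = "2 * (m + k)" in exI, simp,
          rule allI, rule_tac x = "2 * (m + k) + 1" in exI, simp)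
    then show "infinite (s ` {j. k \<le> j \<and> even j})" "infinite (s ` {j. k \<le> j \<and> odd j})"
      using inj by (meson finite_imageD inj_on_subset subset_UNIV)+
  qed
  define V where "V = (\<Union>b\<in>{b \<in> B. b < g}. A b \<inter> Q (e b)) \<union> s ` {j. even j} - s ` {j. odd j}"
  have odd_out: "s j \<notin> V" if "odd j" for j
    using that by (auto simp: V_def)
  have even_in: "s j \<in> V" if "even j" for j
    using that inj by (auto simp: V_def inj_eq)
  have "almost_below {} V \<and> almost_below V UNIV"
  proof -
    have "s ` {j. 0 \<le> j \<and> even j} \<subseteq> V - {}" "s ` {j. 0 \<le> j \<and> odd j} \<subseteq> UNIV - V"
      using even_in odd_out by auto
    then show ?thesis
      using tail[of 0] unfolding almost_below_def by (metis Diff_empty empty_Diff finite.emptyI Diff_UNIV finite_subset)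
  qed
  moreover have "almost_below (A b) V" if b: "b \<in> B" "b < g" for b
  proof -
    have out: "s j \<notin> A b" if "e b \<le> j" for j
      using s(2)[of j] b that by (auto simp: P_def L_def)
    have "A b - V \<subseteq> (\<Union>c\<in>H (e b). A b - A c) \<union> s ` {..<e b}"
    proof
      fix m assume m: "m \<in> A b - V"
      show "m \<in> (\<Union>c\<in>H (e b). A b - A c) \<union> s ` {..<e b}"
      proof (cases "m \<in> Q (e b)")
        case True
        then obtain j where "m = s j"
          using m b by (auto simp: V_def)
        then show ?thesis
          using out[of j] m by force
      qed (use m in \<open>auto simp: Q_def\<close>)
    qed
    moreover have "finite ((\<Union>c\<in>H (e b). A b - A c) \<union> s ` {..<e b})"
      using fin(2)[of "e b"] below b by (intro finite_UnI finite_UN_I) (auto simp: H_def)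
    ultimately have "finite (A b - V)"
      by (rule finite_subset)
    moreover have "s ` {j. e b \<le> j \<and> even j} \<subseteq> V - A b"
      using out even_in by auto
    ultimately show ?thesis
      using tail(1) unfolding almost_below_def by (meson finite_subset)
  qed
  moreover have "almost_below V (A b)" if b: "b \<in> B" "g < b" for b
  proof -
    have inn: "s j \<in> A b" if "e b \<le> j" for j
      using s(2)[of j] b that by (auto simp: Q_def H_def)
    have "V - A b \<subseteq> (\<Union>c\<in>L (e b). A c - A b) \<union> s ` {..<e b}"
    proof
      fix m assume m: "m \<in> V - A b"
      then consider j where "m = s j" | c where "c \<in> B" "c < g" "m \<in> A c" "m \<in> Q (e c)"
        by (auto simp: V_def)
      then show "m \<in> (\<Union>c\<in>L (e b). A c - A b) \<union> s ` {..<e b}"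
      proof cases
        case 1
        then show ?thesis
          using inn[of j] m by force
      next
        case 2
        then have "e c \<le> e b"
          using m b by (force simp: Q_def H_def)
        then show ?thesis
          using 2 m by (auto simp: L_def)
      qed
    qed
    moreover have "finite ((\<Union>c\<in>L (e b). A c - A b) \<union> s ` {..<e b})"
      using fin(1)[of "e b"] below b by (intro finite_UnI finite_UN_I) (auto simp: L_def)
    ultimately have "finite (V - A b)"
      by (rule finite_subset)
    moreover have "s ` {j. e b \<le> j \<and> odd j} \<subseteq> A b - V"
      using inn odd_out by auto
    ultimately show ?thesis
      using tail(2) unfolding almost_below_def by (meson finite_subset)
  qed
  ultimately show ?thesis
    by blast
qed

text \<open>
  The values are chosen by recursion along \<open>R\<close>; at each step only countably many are already present.
\<close>

lemma almost_below_embedding: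
  fixes R :: "real rel" and h :: "'a::linorder \<Rightarrow> real"
  assumes wf: "wf R" and R: "total R" "\<And>a. countable {b. (b, a) \<in> R}" and h: "inj_on h S"
  obtains A :: "'a \<Rightarrow> nat set" where
    "\<And>b. infinite (A b)"
    "\<And>b c. b \<in> S \<Longrightarrow> c \<in> S \<Longrightarrow> b < c \<Longrightarrow> almost_below (A b) (A c)"
proof -
  define W where "W = {(b, a). b \<in> S \<and> a \<in> S \<and> (h b, h a) \<in> R}"
  have wfW: "wf W"
    by (rule wf_subset[OF wf_inv_image[OF wf, of h]]) (auto simp: W_def inv_image_def)
  have cW: "countable {b. (b, a) \<in> W}" for a
  proof (rule countable_image_inj_on[where f = h])
    have "h ` {b. (b, a) \<in> W} \<subseteq> {b. (b, h a) \<in> R}"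
      by (auto simp: W_def)
    then show "countable (h ` {b. (b, a) \<in> W})"
      using R(2) countable_subset by blast
    show "inj_on h {b. (b, a) \<in> W}"
      using h by (rule inj_on_subset) (auto simp: W_def)
  qed
  have tW: "(b, c) \<in> W \<or> (c, b) \<in> W" if "b \<in> S" "c \<in> S" "b \<noteq> c" for b c
    using that R(1) h by (auto simp: W_def total_on_def inj_on_def)
  define P where "P = (\<lambda>(A :: 'a \<Rightarrow> nat set) a V. almost_below {} V \<and> almost_below V UNIV \<and>
      (\<forall>b. (b, a) \<in> W \<longrightarrow> (b < a \<longrightarrow> almost_below (A b) V) \<and> (a < b \<longrightarrow> almost_below V (A b))))"
  have "\<exists>A. \<forall>a. P A a (A a)"
  proof (rule dependent_wf_choice[OF wfW])
    fix a and A :: "'a \<Rightarrow> nat set"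
    assume IH: "\<And>b. (b, a) \<in> W \<Longrightarrow> P A b (A b)"
    have "\<exists>V. almost_below {} V \<and> almost_below V UNIV \<and>
       (\<forall>b\<in>{b. (b, a) \<in> W}. (b < a \<longrightarrow> almost_below (A b) V) \<and> (a < b \<longrightarrow> almost_below V (A b)))"
    proof (rule almost_below_insertion[OF cW])
      fix b c
      assume bc: "b \<in> {b. (b, a) \<in> W}" "c \<in> {b. (b, a) \<in> W}" "b < c"
      then have "(b, c) \<in> W \<or> (c, b) \<in> W"
        using tW[of b c] by (auto simp: W_def)
      then show "almost_below (A b) (A c)"
        using IH[of b] IH[of c] bc by (auto simp: P_def)
    qed (use IH in \<open>auto simp: P_def\<close>)
    then show "\<exists>V. P A a V"
      unfolding P_def by simp
  qed (auto simp: P_def)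
  then obtain A where A: "\<And>a. P A a (A a)"
    by blast
  have "almost_below (A b) (A c)" if "b \<in> S" "c \<in> S" "b < c" for b c
    using tW[of b c] A[of b] A[of c] that unfolding P_def by auto
  moreover have "infinite (A b)" for b
    using A[of b] by (auto simp: P_def almost_below_def)
  ultimately show thesis
    using that by blast
qed

definition almost_mono :: "('l::linorder \<Rightarrow> nat set) \<Rightarrow> bool" where
  "almost_mono A \<longleftrightarrow> (\<forall>x y. x \<le> y \<longrightarrow> finite (A x - A y))"

text \<open>
  A cut with a countable cofinal subset is determined by a sequence of indices of that subset, and
  there are only continuum many sequences of reals.
\<close>

lemma cuts_lepoll_real:
  fixes x :: "real \<Rightarrow> 'l::linorder"
  assumes cof: "\<And>p. range x \<inter> {..p} = range x \<or>
          (\<exists>C\<subseteq>range x \<inter> {..p}. countable C \<and> (\<forall>d\<in>range x \<inter> {..p}. \<exists>c\<in>C. d \<le> c))"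
  shows "range (\<lambda>p. range x \<inter> {..p}) \<lesssim> (UNIV :: real set)"
proof -
  define cut where "cut = (\<lambda>p. range x \<inter> {..p})"
  \<comment> \<open>The entry \<open>s 0\<close> is a tag that sets apart the empty cut and the full cut; the other
    entries enumerate a cofinal subset.\<close>
  define K where "K = (\<lambda>s :: nat \<Rightarrow> real. if s 0 = 0 then {} else if s 0 = 1 then range x
      else {d \<in> range x. \<exists>n>0. d \<le> x (s n)})"
  have "cut p \<in> range K" for p
  proof -
    consider "cut p = range x" | "cut p = {}"
      | C where "cut p \<noteq> {}" "C \<subseteq> cut p" "countable C" "\<forall>d\<in>cut p. \<exists>c\<in>C. d \<le> c"
      using cof[of p] unfolding cut_def by blast
    then show ?thesis
    proof cases
      case 1
      then show ?thesis
        by (intro image_eqI[of _ _ "\<lambda>_. 1"]) (auto simp: K_def)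
    next
      case 2
      then show ?thesis
        by (intro image_eqI[of _ _ "\<lambda>_. 0"]) (auto simp: K_def)
    next
      case 3
      then have "C \<noteq> {}"
        by blast
      then obtain c where c: "C = range (c :: nat \<Rightarrow> 'l)"
        using 3(3) by (metis range_from_nat_into)
      have "C \<subseteq> range x"
        using 3(2) by (auto simp: cut_def)
      then have "\<exists>b. c n = x b" for n
        using c by blast
      then obtain b where b: "\<And>n. c n = x (b n)"
        by metis
      define s where "s = (\<lambda>n. case n of 0 \<Rightarrow> 2 | Suc m \<Rightarrow> b m)"
      have "K s = {d \<in> range x. \<exists>m. d \<le> c m}"
        by (auto simp: K_def s_def b gr0_conv_Suc)
      also have "\<dots> = cut p"
      proof
        show "{d \<in> range x. \<exists>m. d \<le> c m} \<subseteq> cut p"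
        proof safe
          fix a m assume "x a \<le> c m"
          moreover have "c m \<le> p"
            using 3(2) c by (auto simp: cut_def)
          ultimately show "x a \<in> cut p"
            by (simp add: cut_def)
        qed
        show "cut p \<subseteq> {d \<in> range x. \<exists>m. d \<le> c m}"
          using 3(4) c by (auto simp: cut_def)
      qed
      finally show ?thesis
        by blast
    qed
  qed
  then have "range cut \<lesssim> (UNIV :: real set)"
    by (meson real_sequences_lepoll_real image_lepoll lepoll_trans subset_imp_lepoll image_subsetI)
  then show ?thesis
    by (simp add: cut_def)
qed

text \<open>
  One representative \<open>rep p\<close> is chosen in each class of points with the same cut. The representatives
  are few enough to be embedded, and \<open>A\<close> is constant on the classes.
\<close>

lemma almost_mono_family:
  fixes R :: "real rel" and D :: "'l::linorder set"
  assumes R: "wf R" "total R" "\<And>a. countable {b. (b, a) \<in> R}"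
    and cuts: "range (\<lambda>p. D \<inter> {..p}) \<lesssim> (UNIV :: real set)"
  obtains A :: "'l \<Rightarrow> nat set" where "almost_mono A" "\<And>p. infinite (A p)"
    "\<And>p d. d \<in> D \<Longrightarrow> p < d \<Longrightarrow> infinite (A d - A p)"
proof -
  define cut where "cut = (\<lambda>p. D \<inter> {..p})"
  obtain g :: "'l set \<Rightarrow> real" where g: "inj_on g (range cut)"
    using cuts by (auto simp: lepoll_def cut_def)
  define rep where "rep = (\<lambda>p. SOME p'. cut p' = cut p)"
  have cut_rep: "cut (rep p) = cut p" for p
    unfolding rep_def by (rule someI[of "\<lambda>p'. cut p' = cut p"]) simp
  have rep_eq: "rep p = rep p'" if "cut p = cut p'" for p p'
    using that by (simp add: rep_def)
  have "inj_on (g \<circ> cut) (range rep)"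
  proof (rule inj_onI)
    fix p p' assume pp': "p \<in> range rep" "p' \<in> range rep" "(g \<circ> cut) p = (g \<circ> cut) p'"
    then obtain q q' where q: "p = rep q" "p' = rep q'"
      by blast
    have "cut p = cut p'"
      using inj_onD[OF g, of "cut p" "cut p'"] pp'(3) by simp
    then show "p = p'"
      using rep_eq[of q q'] cut_rep q by simp
  qed
  then obtain A0 :: "'l \<Rightarrow> nat set" where A0: "\<And>b. infinite (A0 b)"
    "\<And>b c. b \<in> range rep \<Longrightarrow> c \<in> range rep \<Longrightarrow> b < c \<Longrightarrow> almost_below (A0 b) (A0 c)"
    using almost_below_embedding[OF R] by metis
  define A where "A = A0 \<circ> rep"
  have rep_less: "rep p < rep p'" if "p \<le> p'" "cut p \<noteq> cut p'" for p p'
  proof (rule ccontr)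
    assume "\<not> rep p < rep p'"
    then have "cut (rep p') \<subseteq> cut (rep p)"
      by (auto simp: cut_def)
    moreover have "cut p \<subseteq> cut p'"
      using that by (auto simp: cut_def)
    ultimately show False
      using that cut_rep by simp
  qed
  have A: "almost_mono A"
    unfolding almost_mono_def
  proof (intro allI impI)
    fix p p' :: 'l assume "p \<le> p'"
    then show "finite (A p - A p')"
      using rep_less[of p p'] A0(2)[of "rep p" "rep p'"] rep_eq[of p p']
      by (cases "cut p = cut p'") (auto simp: A_def almost_below_def)
  qed
  have "infinite (A d - A p)" if d: "d \<in> D" and "p < d" for p d
  proof -
    have "d \<in> cut d - cut p"
      using d \<open>p < d\<close> by (auto simp: cut_def)
    then have "cut p \<noteq> cut d"
      by blast
    then have "rep p < rep d"
      using \<open>p < d\<close> by (intro rep_less) auto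
    then show ?thesis
      using A0(2)[of "rep p" "rep d"] by (simp add: A_def almost_below_def)
  qed
  then show thesis
    using that[of A] A A0(1) by (simp add: A_def)
qed

section \<open>The filters attached to the points\<close>

lemma compact_has_lub:
  fixes Z :: "'l::linorder_topology set"
  assumes "compact (UNIV :: 'l set)"
  shows "\<exists>s. (\<forall>z\<in>Z. z \<le> s) \<and> (\<forall>u. (\<forall>z\<in>Z. z \<le> u) \<longrightarrow> s \<le> u)"
proof -
  define Ub where "Ub = {u. \<forall>z\<in>Z. z \<le> u}"
  have "UNIV \<inter> \<Inter>(atLeast ` Z \<union> atMost ` Ub) \<noteq> {}"
  proof (rule compact_imp_fip[OF assms])
    fix F' assume F': "finite F'" "F' \<subseteq> atLeast ` Z \<union> atMost ` Ub"
    obtain Z' where Z': "finite Z'" "Z' \<subseteq> Z" "F' \<inter> atLeast ` Z = atLeast ` Z'"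
      using finite_subset_image[of "F' \<inter> atLeast ` Z" atLeast Z] F' by auto
    obtain U' where U': "finite U'" "U' \<subseteq> Ub" "F' \<inter> atMost ` Ub = atMost ` U'"
      using finite_subset_image[of "F' \<inter> atMost ` Ub" atMost Ub] F' by auto
    have "F' = (F' \<inter> atLeast ` Z) \<union> (F' \<inter> atMost ` Ub)"
      using F'(2) by blast
    then have eq: "F' = atLeast ` Z' \<union> atMost ` U'"
      by (simp only: Z'(3) U'(3))
    note fin = Z'(1,2) U'(1,2)
    have "\<exists>s. (\<forall>z\<in>Z'. z \<le> s) \<and> (\<forall>u\<in>U'. s \<le> u)"
    proof (cases "Z' = {}")
      case True
      then show ?thesis
        using fin by (intro exI[of _ "Min U'"]) auto
    next
      case False
      then have "Max Z' \<in> Z"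
        using fin Max_in by blast
      then show ?thesis
        using fin False by (intro exI[of _ "Max Z'"]) (auto simp: Ub_def)
    qed
    then show "UNIV \<inter> \<Inter>F' \<noteq> {}"
      using eq by auto
  qed auto
  then obtain s where "s \<in> \<Inter>(atLeast ` Z \<union> atMost ` Ub)"
    by blast
  then show ?thesis
    by (intro exI[of _ s]) (auto simp: Ub_def)
qed

text \<open>
  These \<open>y\<close> are the ones with \<open>z\<close> in the interior of \<open>{..y}\<close>, except that the maximum of the order
  is not among them unless it exceeds \<open>z\<close>. So every \<open>y > z\<close> qualifies, and \<open>z\<close> itself does if it has an
  immediate successor.
\<close>

definition right_cuts :: "'l::linorder \<Rightarrow> 'l set" where
  "right_cuts z = {y. \<exists>w>z. \<forall>v<w. v \<le> y}"

text \<open>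
  If \<open>A\<close> increases modulo finite sets, then the ultrafilters finer than this filter are the free
  ultrafilters \<open>p\<close> for which \<open>z\<close> is the infimum of \<open>{x. A x \<in> p}\<close>.
\<close>

definition cut_filter :: "('l::linorder \<Rightarrow> nat set) \<Rightarrow> 'l \<Rightarrow> nat filter" where
  "cut_filter A z =
     inf (inf (INF y\<in>right_cuts z. principal (A y)) (INF x\<in>{..<z}. principal (- A x))) sequentially"

lemma cut_filter_le_sequentially: "cut_filter A z \<le> sequentially"
  by (simp add: cut_filter_def)

lemma eventually_cut_filter_right: "y \<in> right_cuts z \<Longrightarrow> eventually (\<lambda>n. n \<in> A y) (cut_filter A z)"
  unfolding cut_filter_def
  by (rule filter_leD[OF le_infI1[OF le_infI1[OF INF_lower]]]) (auto simp: eventually_principal)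

lemma eventually_cut_filter_left: "x < z \<Longrightarrow> eventually (\<lambda>n. n \<notin> A x) (cut_filter A z)"
  unfolding cut_filter_def
  by (rule filter_leD[OF le_infI1[OF le_infI2[OF INF_lower]]]) (auto simp: eventually_principal)

lemma cut_filter_meets:
  assumes "\<And>Y X. finite Y \<Longrightarrow> Y \<subseteq> right_cuts z \<Longrightarrow> finite X \<Longrightarrow> X \<subseteq> {..<z} \<Longrightarrow>
             infinite (B \<inter> (\<Inter>y\<in>Y. A y) - (\<Union>x\<in>X. A x))"
  shows "frequently (\<lambda>n. n \<in> B) (cut_filter A z)"
proof -
  have False if ev: "eventually (\<lambda>n. n \<notin> B) (cut_filter A z)"
  proof -
    obtain P Q M where P: "eventually P (INF y\<in>right_cuts z. principal (A y))"
      and Q: "eventually Q (INF x\<in>{..<z}. principal (- A x))"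
      and M: "eventually M sequentially" and PQM: "\<And>n. P n \<Longrightarrow> Q n \<Longrightarrow> M n \<Longrightarrow> n \<notin> B"
      using ev unfolding cut_filter_def eventually_inf by metis
    obtain Y where Y: "finite Y" "Y \<subseteq> right_cuts z" "\<And>n. n \<in> (\<Inter>y\<in>Y. A y) \<Longrightarrow> P n"
      using P by (subst (asm) eventually_INF) (auto simp: INF_principal_finite eventually_principal)
    obtain X where X: "finite X" "X \<subseteq> {..<z}" "\<And>n. n \<in> (\<Inter>x\<in>X. - A x) \<Longrightarrow> Q n"
      using Q by (subst (asm) eventually_INF) (auto simp: INF_principal_finite eventually_principal)
    obtain k where k: "\<And>n. k \<le> n \<Longrightarrow> M n"
      using M by (auto simp: eventually_sequentially)
    have "B \<inter> (\<Inter>y\<in>Y. A y) - (\<Union>x\<in>X. A x) \<subseteq> {..<k}"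
      using PQM Y(3) X(3) k by (fastforce simp: not_le[symmetric])
    then show False
      using assms[OF Y(1,2) X(1,2)] finite_subset by blast
  qed
  then show ?thesis
    by (auto simp: frequently_def)
qed

lemma right_cuts_ge: "y \<in> right_cuts z \<Longrightarrow> z \<le> y"
  by (auto simp: right_cuts_def)

lemma cut_filter_nontrivial:
  assumes A: "almost_mono A" and strict: "\<And>x. x < d \<Longrightarrow> infinite (A d - A x)" and inf: "infinite (A d)"
  shows "cut_filter A d \<noteq> bot"
proof -
  have "frequently (\<lambda>n. n \<in> A d) (cut_filter A d)"
  proof (rule cut_filter_meets)
    fix X Y assume Y: "finite Y" "Y \<subseteq> right_cuts d" and X: "finite X" "X \<subseteq> {..<d}"
    have 1: "infinite (A d - (\<Union>x\<in>X. A x))"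
    proof (cases "X = {}")
      case False
      have "finite (A x - A (Max X))" if "x \<in> X" for x
        using A X that by (auto simp: almost_mono_def)
      then have "finite (\<Union>x\<in>X. A x - A (Max X))"
        using X by blast
      moreover have "infinite (A d - A (Max X))"
        using strict X False Max_in by blast
      moreover have "A d - A (Max X) \<subseteq> (A d - (\<Union>x\<in>X. A x)) \<union> (\<Union>x\<in>X. A x - A (Max X))"
        by blast
      ultimately show ?thesis
        by (meson finite_UnI finite_subset)
    qed (use inf in auto)
    have "finite (A d - A y)" if "y \<in> Y" for y
      using A right_cuts_ge[of y d] Y that by (auto simp: almost_mono_def)
    then have 2: "finite (\<Union>y\<in>Y. A d - A y)"
      using Y by blast
    have "A d - (\<Union>x\<in>X. A x) \<subseteq> (A d \<inter> (\<Inter>y\<in>Y. A y) - (\<Union>x\<in>X. A x)) \<union> (\<Union>y\<in>Y. A d - A y)"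
      by blast
    then show "infinite (A d \<inter> (\<Inter>y\<in>Y. A y) - (\<Union>x\<in>X. A x))"
      using 1 2 by (meson finite_UnI finite_subset)
  qed
  then show ?thesis
    by (auto simp: frequently_def)
qed

text \<open>
  In terms of ultrafilters, every free ultrafilter is sent to some point. Here an infinite set
  \<open>B\<close> on which \<open>P\<close> fails plays the role of the ultrafilter, and its point is the infimum of the
  \<open>z\<close> for which \<open>B \<inter> A z\<close> is infinite.
\<close>

lemma cut_filters_cover:
  fixes A :: "'l::linorder_topology \<Rightarrow> nat set"
  assumes cpt: "compact (UNIV :: 'l set)" and A: "almost_mono A"
    and P: "\<And>z. eventually P (cut_filter A z)"
  shows "eventually P sequentially"
proof (rule ccontr)
  define B where "B = {n. \<not> P n}"
  assume "\<not> eventually P sequentially"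
  then have B: "infinite B"
    unfolding B_def by (simp add: cofinite_eq_sequentially[symmetric] eventually_cofinite)
  define Z where "Z = {z. infinite (B \<inter> A z)}"
  obtain s where s: "\<And>l. (\<forall>z\<in>Z. l \<le> z) \<Longrightarrow> l \<le> s" "\<And>u. (\<And>l. (\<forall>z\<in>Z. l \<le> z) \<Longrightarrow> l \<le> u) \<Longrightarrow> s \<le> u"
    using compact_has_lub[OF cpt, of "{l. \<forall>z\<in>Z. l \<le> z}"] by auto
  have lb: "s \<le> z" if "z \<in> Z" for z
    using s(2) that by blast
  have "frequently (\<lambda>n. n \<in> B) (cut_filter A s)"
  proof (rule cut_filter_meets)
    fix X Y assume Y: "finite Y" "Y \<subseteq> right_cuts s" and X: "finite X" "X \<subseteq> {..<s}"
    have YZ: "y \<in> Z" if y: "y \<in> Y" for y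
    proof -
      obtain w where w: "s < w" "\<And>v. v < w \<Longrightarrow> v \<le> y"
        using y Y by (auto simp: right_cuts_def)
      obtain z where z: "z \<in> Z" "z < w"
        using s(1)[of w] w(1) by fastforce
      then have "finite (B \<inter> A z - A y)"
        using A w(2) by (auto simp: almost_mono_def intro: finite_subset[of _ "A z - A y"])
      moreover have "B \<inter> A z \<subseteq> (B \<inter> A y) \<union> (B \<inter> A z - A y)"
        by blast
      ultimately show ?thesis
        using z unfolding Z_def mem_Collect_eq by (meson finite_UnI finite_subset)
    qed
    have 1: "infinite (B \<inter> (\<Inter>y\<in>Y. A y))"
    proof (cases "Y = {}")
      case False
      have "finite (A (Min Y) - A y)" if "y \<in> Y" for y
        using A Y that by (auto simp: almost_mono_def)
      then have "finite (\<Union>y\<in>Y. A (Min Y) - A y)"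
        using Y by blast
      moreover have "infinite (B \<inter> A (Min Y))"
        using YZ[of "Min Y"] Y False by (auto simp: Z_def)
      moreover have "B \<inter> A (Min Y) \<subseteq> (B \<inter> (\<Inter>y\<in>Y. A y)) \<union> (\<Union>y\<in>Y. A (Min Y) - A y)"
        by blast
      ultimately show ?thesis
        by (meson finite_UnI finite_subset)
    qed (use B in auto)
    have "finite (B \<inter> A x)" if "x \<in> X" for x
    proof -
      have "x \<notin> Z"
        using lb[of x] X(2) that by auto
      then show ?thesis
        by (simp add: Z_def)
    qed
    then have "finite (\<Union>x\<in>X. B \<inter> A x)"
      using X by blast
    moreover have "B \<inter> (\<Inter>y\<in>Y. A y) \<subseteq> (B \<inter> (\<Inter>y\<in>Y. A y) - (\<Union>x\<in>X. A x)) \<union> (\<Union>x\<in>X. B \<inter> A x)"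
      by blast
    ultimately show "infinite (B \<inter> (\<Inter>y\<in>Y. A y) - (\<Union>x\<in>X. A x))"
      using 1 by (meson finite_UnI finite_subset)
  qed
  then show False
    using P[of s] by (simp add: frequently_def B_def)
qed

section \<open>The twisted sum\<close>

text \<open>
  By compactness, finitely many intervals on which \<open>f\<close> oscillates little cover the space; \<open>S\<close>
  collects their left ends.
\<close>

lemma finite_separating_set:
  fixes f :: "'l::linorder_topology \<Rightarrow> real"
  assumes cpt: "compact (UNIV :: 'l set)" and f: "continuous_on UNIV f" and "\<epsilon> > 0"
  shows "\<exists>S. finite S \<and> (\<forall>x y. x < y \<longrightarrow> {x..<y} \<inter> S = {} \<longrightarrow> \<bar>f x - f y\<bar> < \<epsilon>)"
proof -
  have "\<exists>J S. open J \<and> z \<in> J \<and> J \<subseteq> f -` ball (f z) (\<epsilon> / 2) \<and> finite S \<and>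
          (\<forall>y\<in>J. \<forall>x<y. {x..<y} \<inter> S = {} \<longrightarrow> x \<in> J)" for z
  proof -
    have "open (f -` ball (f z) (\<epsilon> / 2))"
      using f by (simp add: continuous_on_eq_continuous_at open_vimage continuous_at_imp_continuous_on)
    then show ?thesis
      using interval_neighbourhood[of "f -` ball (f z) (\<epsilon> / 2)" z] \<open>\<epsilon> > 0\<close> by (metis centre_in_ball half_gt_zero vimageI2)
  qed
  then obtain J S where J: "\<And>z. open (J z)" "\<And>z. z \<in> J z" "\<And>z. J z \<subseteq> f -` ball (f z) (\<epsilon> / 2)"
    and S: "\<And>z. finite (S z)" "\<And>z. \<forall>y\<in>J z. \<forall>x<y. {x..<y} \<inter> S z = {} \<longrightarrow> x \<in> J z"
    by metis
  obtain Z where Z: "finite Z" "UNIV \<subseteq> (\<Union>z\<in>Z. J z)"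
    by (rule compactE_image[OF cpt, of UNIV J]) (use J in auto)
  have "\<bar>f x - f y\<bar> < \<epsilon>" if xy: "x < y" "{x..<y} \<inter> (\<Union>z\<in>Z. S z) = {}" for x y
  proof -
    obtain z where z: "z \<in> Z" "y \<in> J z"
      using Z by blast
    then have "x \<in> J z"
      using bspec[OF S(2)[of z] z(2)] xy by blast
    then have "dist (f z) (f x) < \<epsilon> / 2" "dist (f z) (f y) < \<epsilon> / 2"
      using J(3)[of z] z(2) by auto
    then show ?thesis
      unfolding dist_real_def by linarith
  qed
  then show ?thesis
    using Z(1) S(1) by (intro exI[of _ "\<Union>z\<in>Z. S z"]) blast
qed

definition pullback_space :: "('l::linorder_topology \<Rightarrow> nat set) \<Rightarrow> ((nat \<Rightarrow>\<^sub>C real) \<times> ('l \<Rightarrow>\<^sub>C real)) set" where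
  "pullback_space A = {(u, f). \<forall>z. (apply_bcontfun u \<longlongrightarrow> apply_bcontfun f z) (cut_filter A z)}"

lemma closed_limit_relation:
  fixes z :: "'l::topological_space"
  shows "closed {p :: (nat \<Rightarrow>\<^sub>C real) \<times> ('l \<Rightarrow>\<^sub>C real). (apply_bcontfun (fst p) \<longlongrightarrow> apply_bcontfun (snd p) z) F}"
  unfolding closed_sequential_limits
proof (intro allI impI, elim conjE, unfold mem_Collect_eq)
  fix x :: "nat \<Rightarrow> (nat \<Rightarrow>\<^sub>C real) \<times> ('l \<Rightarrow>\<^sub>C real)" and l
  assume x: "\<forall>n. (apply_bcontfun (fst (x n)) \<longlongrightarrow> apply_bcontfun (snd (x n)) z) F" and lim: "x \<longlonglongrightarrow> l"
  show "(apply_bcontfun (fst l) \<longlongrightarrow> apply_bcontfun (snd l) z) F"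
  proof (rule tendstoI)
    fix e :: real assume "e > 0"
    then obtain n where n: "dist (x n) l < e / 3"
      using lim by (metis lim_sequentially order_refl zero_less_divide_iff zero_less_numeral)
    have 1: "dist (fst (x n) m) (fst l m) < e / 3" for m
      using dist_bounded[of "fst (x n)" m "fst l"] dist_fst_le[of "x n" l] n by linarith
    have 2: "dist (snd (x n) z) (snd l z) < e / 3"
      using dist_bounded[of "snd (x n)" z "snd l"] dist_snd_le[of "x n" l] n by linarith
    have "eventually (\<lambda>m. dist (fst (x n) m) (snd (x n) z) < e / 3) F"
      by (rule tendstoD) (use x \<open>e > 0\<close> in auto)
    then show "eventually (\<lambda>m. dist (fst l m) (snd l z) < e) F"
    proof eventually_elim
      case (elim m)
      then show ?case
        using 1[of m] 2 unfolding dist_real_def by linarith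
    qed
  qed
qed

lemma bcontfun_Cauchy_convergent:
  fixes s :: "nat \<Rightarrow> 'a::topological_space \<Rightarrow>\<^sub>C 'b::complete_space"
  assumes "Cauchy s"
  shows "convergent s"
proof -
  have "uniformly_Cauchy_on UNIV (\<lambda>n. apply_bcontfun (s n))"
    using assms unfolding uniformly_Cauchy_on_def Cauchy_def by (meson dist_fun_lt_imp_dist_val_lt)
  then obtain g where "uniform_limit UNIV (\<lambda>n. apply_bcontfun (s n)) g sequentially"
    using Cauchy_uniformly_convergent uniformly_convergent_on_def by blast
  then obtain l where "s \<longlonglongrightarrow> l"
    using uniform_limit_bcontfunE sequentially_bot by metis
  then show ?thesis
    by (rule convergentI)
qed

text \<open>
  Completeness is a premise, not a class constraint, as the spaces of interest consist of functions
  on a space that need not carry a metric.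
\<close>

lemma closed_subspace_banach_on:
  fixes X :: "'v::real_normed_vector set"
  assumes "\<And>s :: nat \<Rightarrow> 'v. Cauchy s \<Longrightarrow> convergent s" and "subspace X" "closed X"
  shows "banach_on X norm"
  unfolding banach_on_def
proof (intro conjI)
  show "norm_on X norm"
    unfolding norm_on_def by (auto intro: norm_triangle_ineq)
  show "complete_norm_on X norm"
    unfolding complete_norm_on_def
  proof (intro allI impI, elim conjE)
    fix s :: "nat \<Rightarrow> 'v"
    assume s: "range s \<subseteq> X" and "\<forall>e>0. \<exists>k. \<forall>m\<ge>k. \<forall>n\<ge>k. norm (s m - s n) < e"
    then have "Cauchy s"
      by (simp add: Cauchy_iff)
    then obtain x where x: "s \<longlonglongrightarrow> x"
      using assms(1) convergent_def by blast
    then have "x \<in> X"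
      using s \<open>closed X\<close> closed_sequentially by blast
    then show "\<exists>x\<in>X. (\<lambda>n. norm (s n - x)) \<longlonglongrightarrow> 0"
      using x by (intro bexI[of _ x]) (simp_all add: tendsto_norm_zero_iff LIM_zero_iff)
  qed
qed fact

lemma banach_on_c0: "banach_on c0 norm"
proof (rule closed_subspace_banach_on[OF bcontfun_Cauchy_convergent])
  show "subspace c0"
    unfolding subspace_def c0_def
    by (auto intro: tendsto_add_zero tendsto_mult_right_zero)
  have "c0 = (\<lambda>u. (u, 0 :: nat \<Rightarrow>\<^sub>C real)) -` {p. (apply_bcontfun (fst p) \<longlongrightarrow> apply_bcontfun (snd p) 0) sequentially}"
    by (auto simp: c0_def)
  moreover have "closed \<dots>"
    by (intro closed_vimage closed_limit_relation continuous_intros)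
  ultimately show "closed c0"
    by simp
qed

lemma banach_on_pullback_space: "banach_on (pullback_space A) norm"
proof (rule closed_subspace_banach_on)
  fix s :: "nat \<Rightarrow> (nat \<Rightarrow>\<^sub>C real) \<times> ('a \<Rightarrow>\<^sub>C real)"
  assume "Cauchy s"
  then have "convergent (\<lambda>n. fst (s n))" "convergent (\<lambda>n. snd (s n))"
    by (auto intro: bcontfun_Cauchy_convergent Cauchy_fst Cauchy_snd)
  then obtain u f where "(\<lambda>n. fst (s n)) \<longlonglongrightarrow> u" "(\<lambda>n. snd (s n)) \<longlonglongrightarrow> f"
    by (auto simp: convergent_def)
  then have "(\<lambda>n. (fst (s n), snd (s n))) \<longlonglongrightarrow> (u, f)"
    by (rule tendsto_Pair)
  then show "convergent s"
    by (auto intro: convergentI)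
next
  show "subspace (pullback_space A)"
    unfolding subspace_def pullback_space_def
    by (auto simp: zero_prod_def intro!: tendsto_add tendsto_mult_left)
  have "pullback_space A =
      (\<Inter>z. {p. (apply_bcontfun (fst p) \<longlongrightarrow> apply_bcontfun (snd p) z) (cut_filter A z)})"
    by (auto simp: pullback_space_def)
  then show "closed (pullback_space A)"
    by (auto intro!: closed_INT closed_limit_relation)
qed

lemma pullback_space_kernel:
  fixes A :: "'l::linorder_topology \<Rightarrow> nat set"
  assumes cpt: "compact (UNIV :: 'l set)" and A: "almost_mono A"
  shows "(u, 0) \<in> pullback_space A \<longleftrightarrow> u \<in> c0"
proof
  assume "(u, 0) \<in> pullback_space A"
  then have u: "(apply_bcontfun u \<longlongrightarrow> 0) (cut_filter A z)" for z
    by (simp add: pullback_space_def)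
  have "apply_bcontfun u \<longlonglongrightarrow> 0"
  proof (rule tendstoI)
    fix e :: real assume "e > 0"
    then show "eventually (\<lambda>n. dist (apply_bcontfun u n) 0 < e) sequentially"
      by (intro cut_filters_cover[OF cpt A] tendstoD[OF u])
  qed
  then show "u \<in> c0"
    by (simp add: c0_def)
next
  assume "u \<in> c0"
  then show "(u, 0) \<in> pullback_space A"
    using tendsto_mono[OF cut_filter_le_sequentially] by (auto simp: c0_def pullback_space_def)
qed

text \<open>
  Let \<open>T k\<close> be finite sets, increasing in \<open>k\<close>, such that \<open>f\<close> varies by less than \<open>1 / (k + 1)\<close>
  between points that \<open>T k\<close> does not separate. For fixed \<open>k\<close> and all large \<open>n\<close>, membership of \<open>n\<close> in
  \<open>A s\<close> is exactly monotone in \<open>s \<in> T k\<close>, so \<open>n\<close> defines a cut of \<open>T k\<close>. Let \<open>\<kappa> n\<close> be the largest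
  such \<open>k \<le> n\<close>, let \<open>t n\<close> be the point of \<open>T (\<kappa> n)\<close> at that cut, and put \<open>u n = f (t n)\<close>. This \<open>u\<close> is
  bounded by the norm of \<open>f\<close>, which is what later makes the functionals bounded.
\<close>

lemma pullback_space_surj:
  fixes A :: "'l::linorder_topology \<Rightarrow> nat set" and f :: "'l \<Rightarrow>\<^sub>C real"
  assumes cpt: "compact (UNIV :: 'l set)" and A: "almost_mono A"
  shows "\<exists>u. (u, f) \<in> pullback_space A \<and> norm u \<le> norm f"
proof -
  obtain tp :: 'l where tp: "\<And>x. x \<le> tp"
    using compact_has_lub[OF cpt, of UNIV] by auto
  have "\<exists>S. finite S \<and> (\<forall>x y. x < y \<longrightarrow> {x..<y} \<inter> S = {} \<longrightarrow> \<bar>f x - f y\<bar> < inverse (real (Suc k)))" for k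
    by (rule finite_separating_set[OF cpt]) auto
  then obtain S where S: "\<And>k. finite (S k)"
    "\<And>k x y. x < y \<Longrightarrow> {x..<y} \<inter> S k = {} \<Longrightarrow> \<bar>f x - f y\<bar> < inverse (real (Suc k))"
    by metis
  define T where "T = (\<lambda>k. \<Union>i\<le>k. S i)"
  have T: "finite (T k)" for k
    using S(1) by (simp add: T_def)
  have Tmono: "T k \<subseteq> T l" if "k \<le> l" for k l
    using that by (force simp: T_def)
  have sep: "\<bar>f x - f y\<bar> < inverse (real (Suc k))" if "x < y" "{x..<y} \<inter> T k = {}" for x y k
    using that by (intro S(2)) (auto simp: T_def)
  define good where "good = (\<lambda>n k. \<forall>s\<in>T k. \<forall>s'\<in>T k. s \<le> s' \<longrightarrow> n \<in> A s \<longrightarrow> n \<in> A s')"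
  have ev_good: "eventually (\<lambda>n. good n k) sequentially" for k
  proof -
    have "eventually (\<lambda>n. s \<le> s' \<longrightarrow> n \<in> A s \<longrightarrow> n \<in> A s') sequentially" for s s'
    proof (cases "s \<le> s'")
      case True
      then have "finite {n. \<not> (n \<in> A s \<longrightarrow> n \<in> A s')}"
        using A by (auto simp: almost_mono_def set_diff_eq)
      then show ?thesis
        using True by (simp add: cofinite_eq_sequentially[symmetric] eventually_cofinite)
    qed simp
    then show ?thesis
      unfolding good_def using T by (simp add: eventually_ball_finite)
  qed
  define \<kappa> where "\<kappa> = (\<lambda>n. Max (insert 0 {k. k \<le> n \<and> good n k}))"
  have \<kappa>: "k \<le> \<kappa> n \<and> good n (\<kappa> n)" if "k \<le> n" "good n k" for k n
  proof -
    have fin: "finite (insert 0 {k. k \<le> n \<and> good n k})"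
      by simp
    then have "k \<le> \<kappa> n"
      unfolding \<kappa>_def using that by (intro Max_ge) auto
    moreover have "\<kappa> n \<in> insert 0 {k. k \<le> n \<and> good n k}"
      unfolding \<kappa>_def by (intro Max_in) auto
    ultimately show ?thesis
      using that by auto
  qed
  define t where "t = (\<lambda>n. if \<exists>s\<in>T (\<kappa> n). n \<in> A s then Min {s \<in> T (\<kappa> n). n \<in> A s} else tp)"
  have bc: "(\<lambda>n. f (t n)) \<in> bcontfun"
    by (rule bcontfun_normI[of _ "norm f"]) (use norm_bounded[of f] in auto)
  define u where "u = Bcontfun (\<lambda>n. f (t n))"
  have u: "apply_bcontfun u n = f (t n)" for n
    using bc by (simp add: u_def Bcontfun_inverse)
  have "norm u \<le> norm f"
    by (rule norm_bound) (use norm_bounded[of f] in \<open>simp add: u\<close>)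
  moreover have "(apply_bcontfun u \<longlongrightarrow> f z) (cut_filter A z)" for z
  proof (rule tendstoI)
    fix e :: real assume "e > 0"
    then obtain k where k: "inverse (real (Suc k)) < e / 2"
      using reals_Archimedean[of "e / 2"] by auto
    let ?\<delta> = "inverse (real (Suc k))"
    have 1: "eventually (\<lambda>n. k \<le> n \<and> good n k) (cut_filter A z)"
      by (intro filter_leD[OF cut_filter_le_sequentially] eventually_conj ev_good eventually_ge_at_top)
    have 2: "eventually (\<lambda>n. \<forall>s\<in>T k. (s < z \<longrightarrow> n \<notin> A s) \<and> (s \<in> right_cuts z \<longrightarrow> n \<in> A s)) (cut_filter A z)"
      by (intro eventually_ball_finite T ballI eventually_conj)
        (auto intro: eventually_cut_filter_left eventually_cut_filter_right)
    show "eventually (\<lambda>n. dist (apply_bcontfun u n) (f z) < e) (cut_filter A z)"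
      using 1 2
    proof eventually_elim
      case (elim n)
      then have \<kappa>n: "k \<le> \<kappa> n" "good n (\<kappa> n)"
        using \<kappa>[of k n] by auto
      then have sub: "T k \<subseteq> T (\<kappa> n)"
        by (intro Tmono)
      have tin: "t n \<in> T (\<kappa> n) \<and> n \<in> A (t n) \<or> t n = tp"
        using Min_in[of "{s \<in> T (\<kappa> n). n \<in> A s}"] T by (auto simp: t_def)
      have tgt: "s < t n" if "s \<in> T k" "s < z" for s
      proof (rule ccontr)
        assume "\<not> s < t n"
        moreover have "n \<notin> A s"
          using elim that by blast
        moreover have "t n \<noteq> tp"
          using \<open>\<not> s < t n\<close> that tp[of z] by auto
        ultimately show False
          using tin \<kappa>n(2) that(1) sub unfolding good_def by (meson not_less subsetD)
      qed
      have tle: "t n \<le> s" if "s \<in> T k" "s \<in> right_cuts z" for s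
      proof -
        have "s \<in> {s \<in> T (\<kappa> n). n \<in> A s}"
          using elim that sub by blast
        then show ?thesis
          using T by (auto simp: t_def)
      qed
      have rc: "s \<in> right_cuts z" if "z < s" for s
        using that by (auto simp: right_cuts_def)
      have "\<bar>f (t n) - f z\<bar> < e"
      proof (cases "t n" z rule: linorder_cases)
        case less
        have "{t n..<z} \<inter> T k = {}"
          using tgt by force
        then show ?thesis
          using sep[OF less] k \<open>e > 0\<close> by fastforce
      next
        case greater
        show ?thesis
        proof (cases "{z..<t n} \<inter> T k = {}")
          case True
          then show ?thesis
            using sep[OF greater] k \<open>e > 0\<close> by fastforce
        next
          case False
          \<comment> \<open>Any other separating point would lie in \<open>right_cuts z\<close>, hence not below \<open>t n\<close>.\<close>
          then have z: "z \<in> T k" "z \<notin> right_cuts z"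
            using tle rc by (force simp: not_less[symmetric])+
          have "open (f -` ball (f z) ?\<delta>)"
            by (intro open_vimage) auto
          then obtain b where b: "z < b" "{z..<b} \<subseteq> f -` ball (f z) ?\<delta>"
            using open_right[of "f -` ball (f z) ?\<delta>" z "t n"] greater by auto
          \<comment> \<open>As \<open>z\<close> has no immediate successor, \<open>f z\<close> can be compared with \<open>f (t n)\<close> through a
            point \<open>v\<close> just above \<open>z\<close>.\<close>
          obtain v where v: "z < v" "v < min b (t n)"
            using z(2) b(1) greater unfolding right_cuts_def by (auto simp: not_le) (metis min_less_iff_conj)
          then have "v \<in> {z..<b}"
            by auto
          with b(2) have "v \<in> f -` ball (f z) ?\<delta>"
            by blast
          then have "\<bar>f z - f v\<bar> < ?\<delta>"
            by (simp add: dist_real_def)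
          moreover have "{v..<t n} \<inter> T k = {}"
            using tle rc v by force
          then have "\<bar>f v - f (t n)\<bar> < ?\<delta>"
            using v by (intro sep) auto
          ultimately show ?thesis
            using k by linarith
        qed
      qed (use \<open>e > 0\<close> in simp)
      then show ?case
        by (simp add: u dist_real_def)
    qed
  qed
  ultimately show ?thesis
    by (auto simp: pullback_space_def)
qed

lemma twisted_sum_pullback_space:
  fixes A :: "'l::linorder_topology \<Rightarrow> nat set"
  assumes cpt: "compact (UNIV :: 'l set)" and A: "almost_mono A"
  shows "twisted_sum c0 norm (UNIV :: ('l \<Rightarrow>\<^sub>C real) set) norm (pullback_space A) norm (\<lambda>u. (u, 0)) snd"
  unfolding twisted_sum_def
proof (intro conjI)
  note ker = pullback_space_kernel[OF cpt A]
  show "banach_on (UNIV :: ('l \<Rightarrow>\<^sub>C real) set) norm"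
    by (rule closed_subspace_banach_on[OF bcontfun_Cauchy_convergent]) auto
  show "bounded_linear_on c0 norm (pullback_space A) norm (\<lambda>u. (u, 0))"
    unfolding bounded_linear_on_def using ker by (auto intro!: exI[of _ 1] simp: norm_Pair)
  show "bounded_linear_on (pullback_space A) norm UNIV norm snd"
    unfolding bounded_linear_on_def by (auto intro!: exI[of _ 1] simp: norm_snd_le)
  show "inj_on (\<lambda>u. (u, 0 :: 'l \<Rightarrow>\<^sub>C real)) c0"
    by (auto simp: inj_on_def)
  show "(\<lambda>u. (u, 0)) ` c0 = {x \<in> pullback_space A. snd x = 0}"
    using ker by force
  show "snd ` pullback_space A = UNIV"
    using pullback_space_surj[OF cpt A] by force
qed (rule banach_on_c0 banach_on_pullback_space)+

section \<open>Functionals on the space of continuous functions\<close>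

text \<open>
  Only functions supported by an order-convex set \<open>J\<close> are tested, so that \<open>E\<close> can stay countable: it
  meets each interval that \<open>\<mu>\<close> charges. For instance, the rationals carry the Lebesgue integral on
  the unit interval.
\<close>

definition carried_by :: "'l::linorder_topology set \<Rightarrow> (('l \<Rightarrow>\<^sub>C real) \<Rightarrow> real) \<Rightarrow> bool" where
  "carried_by E \<mu> \<longleftrightarrow> (\<forall>f J. (\<forall>a\<in>J. \<forall>b\<in>J. {a..b} \<subseteq> J) \<longrightarrow> J \<inter> E = {} \<longrightarrow>
     (\<forall>x. x \<notin> J \<longrightarrow> apply_bcontfun f x = 0) \<longrightarrow> \<mu> f = 0)"

text \<open>
  For a closed set \<open>W\<close>, the value \<open>V W\<close> is the total variation of \<open>\<mu>\<close>, regarded as a measure, on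
  the complement of \<open>W\<close>. The increasing function \<open>p \<mapsto> V {p..}\<close> thus measures \<open>{..<p}\<close>, and \<open>E\<close>
  consists of the points \<open>c q\<close> at which it passes a rational level \<open>q\<close>. If \<open>\<mu>\<close> does not
  vanish on a function supported by \<open>J\<close>, then it charges some \<open>{a..b} \<subseteq> J\<close>; a rational level is
  passed there, and \<open>c q \<in> {a..b}\<close>.
\<close>

lemma functional_countably_carried:
  fixes \<mu> :: "('l::linorder_topology \<Rightarrow>\<^sub>C real) \<Rightarrow> real"
  assumes cpt: "compact (UNIV :: 'l set)" and \<mu>: "bounded_linear \<mu>"
  shows "\<exists>E. countable E \<and> carried_by E \<mu>"
proof -
  interpret \<mu>: bounded_linear \<mu> by fact
  obtain K where K: "K > 0" "\<And>f. \<bar>\<mu> f\<bar> \<le> norm f * K"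
    using \<mu>.pos_bounded by auto
  define H where "H = (\<lambda>W. {h :: 'l \<Rightarrow>\<^sub>C real. norm h \<le> 1 \<and> (\<forall>x\<in>W. apply_bcontfun h x = 0)})"
  define V where "V = (\<lambda>W. Sup (\<mu> ` H W))"
  have bdd: "bdd_above (\<mu> ` H W)" for W
  proof (rule bdd_aboveI2)
    fix h assume "h \<in> H W"
    then have "norm h * K \<le> 1 * K"
      using K(1) by (intro mult_right_mono) (auto simp: H_def)
    then show "\<mu> h \<le> K"
      using K(2)[of h] by linarith
  qed
  have "0 \<in> H W" for W
    by (simp add: H_def)
  then have ne: "\<mu> ` H W \<noteq> {}" for W
    by blast
  have Vmono: "V W \<le> V W'" if "W' \<subseteq> W" for W W'
    unfolding V_def by (rule cSup_subset_mono[OF ne bdd]) (use that in \<open>auto simp: H_def\<close>)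
  have "\<exists>c. (\<forall>x. V {x..} \<le> q \<longrightarrow> x \<le> c) \<and> (\<forall>u. (\<forall>x. V {x..} \<le> q \<longrightarrow> x \<le> u) \<longrightarrow> c \<le> u)" for q
    using compact_has_lub[OF cpt, of "{x. V {x..} \<le> q}"] by simp
  then obtain c where c: "\<And>q x. V {x..} \<le> q \<Longrightarrow> x \<le> c q"
    "\<And>q u. (\<And>x. V {x..} \<le> q \<Longrightarrow> x \<le> u) \<Longrightarrow> c q \<le> u"
    by metis
  have "\<mu> f = 0" if J: "\<forall>a\<in>J. \<forall>b\<in>J. {a..b} \<subseteq> J" "J \<inter> c ` \<rat> = {}"
    and f: "\<And>x. x \<notin> J \<Longrightarrow> apply_bcontfun f x = 0" for f J
  proof (rule ccontr)
    assume nz: "\<mu> f \<noteq> 0"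
    \<comment> \<open>Values of \<open>f\<close> of size at most \<open>\<delta>\<close> are cut off, to make the support a compact subset of \<open>J\<close>.
      The bound \<open>K\<close> ensures that \<open>\<mu>\<close> changes by at most half of \<open>\<mu> f\<close>.\<close>
    define \<delta> where "\<delta> = \<bar>\<mu> f\<bar> / (2 * K)"
    have \<delta>: "\<delta> > 0"
      using nz K by (simp add: \<delta>_def)
    have bc: "(\<lambda>x. f x - max (- \<delta>) (min \<delta> (f x))) \<in> bcontfun"
    proof (rule bcontfun_normI)
      show "continuous_on UNIV (\<lambda>x. f x - max (- \<delta>) (min \<delta> (f x)))"
        by (intro continuous_intros) auto
      show "norm (f x - max (- \<delta>) (min \<delta> (f x))) \<le> norm f" for x
        using norm_bounded[of f x] \<delta> by (auto simp: max_def min_def)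
    qed
    define g where "g = Bcontfun (\<lambda>x. f x - max (- \<delta>) (min \<delta> (f x)))"
    have g: "apply_bcontfun g x = f x - max (- \<delta>) (min \<delta> (f x))" for x
      using bc by (simp add: g_def Bcontfun_inverse)
    have "norm (f - g) \<le> \<delta>"
      by (rule norm_bound) (use \<delta> in \<open>auto simp: g max_def min_def\<close>)
    then have "\<bar>\<mu> f - \<mu> g\<bar> \<le> \<delta> * K"
      using K(2)[of "f - g"] K(1) by (metis \<mu>.diff mult_right_mono less_imp_le order_trans)
    then have "\<bar>\<mu> f - \<mu> g\<bar> \<le> \<bar>\<mu> f\<bar> / 2"
      using K(1) by (simp add: \<delta>_def)
    then have g0: "\<mu> g \<noteq> 0"
      using nz by auto
    define W where "W = {x. \<delta> \<le> \<bar>apply_bcontfun f x\<bar>}"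
    have gW: "apply_bcontfun g x = 0" if "x \<notin> W" for x
      using that by (auto simp: g W_def max_def min_def)
    have "closed W"
      unfolding W_def by (intro closed_Collect_le continuous_intros) auto
    then have "compact W"
      using compact_Int_closed[OF cpt, of W] by simp
    have "W \<noteq> {}"
    proof
      assume "W = {}"
      then have "g = 0"
        using gW by (intro bcontfun_eqI) auto
      then show False
        using g0 \<mu>.zero by simp
    qed
    obtain a where a: "a \<in> W" "\<And>x. x \<in> W \<Longrightarrow> a \<le> x"
      using compact_attains_inf[OF \<open>compact W\<close> \<open>W \<noteq> {}\<close>] by blast
    obtain b where b: "b \<in> W" "\<And>x. x \<in> W \<Longrightarrow> x \<le> b"
      using compact_attains_sup[OF \<open>compact W\<close> \<open>W \<noteq> {}\<close>] by blast
    have "W \<subseteq> J"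
      using f \<delta> by (force simp: W_def)
    then have abJ: "{a..b} \<subseteq> J"
      using J(1) a(1) b(1) by blast
    define g' where "g' = (sgn (\<mu> g) / norm g) *\<^sub>R g"
    have gnz: "g \<noteq> 0"
      using g0 \<mu>.zero by auto
    then have g': "norm g' = 1" "\<mu> g' > 0"
      using g0 by (auto simp: g'_def \<mu>.scaleR sgn_if zero_less_divide_iff)
    have g'0: "apply_bcontfun g' x = 0" if "x < a \<or> b < x" for x
      using gW[of x] a b that by (force simp: g'_def)
    \<comment> \<open>Functions with disjoint supports can be added without increasing the norm.\<close>
    have "V {a..} \<le> V {b<..} - \<mu> g'"
      unfolding V_def
    proof (rule cSup_least[OF ne])
      fix y assume "y \<in> \<mu> ` H {a..}"
      then obtain h where h: "y = \<mu> h" "norm h \<le> 1" "\<And>x. a \<le> x \<Longrightarrow> apply_bcontfun h x = 0"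
        by (auto simp: H_def)
      have "norm (h + g') \<le> 1"
      proof (rule norm_bound)
        fix x
        show "norm (apply_bcontfun (h + g') x) \<le> 1"
          using h(3)[of x] g'0[of x] norm_bounded[of h x] norm_bounded[of g' x] h(2) g'(1)
          by (cases "a \<le> x") (auto simp: not_le)
      qed
      moreover have "apply_bcontfun (h + g') x = 0" if "b < x" for x
        using h(3)[of x] g'0[of x] that a(2)[OF b(1)] by auto
      ultimately have "h + g' \<in> H {b<..}"
        by (auto simp: H_def)
      then have "\<mu> (h + g') \<le> Sup (\<mu> ` H {b<..})"
        by (intro cSup_upper bdd) auto
      then show "y \<le> Sup (\<mu> ` H {b<..}) - \<mu> g'"
        using h(1) by (simp add: \<mu>.add)
    qed
    then obtain q where q: "q \<in> \<rat>" "V {a..} < q" "q < V {b<..}"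
      using g'(2) Rats_dense_in_real[of "V {a..}" "V {b<..}"] by auto
    have "a \<le> c q"
      using q(2) by (intro c(1)) auto
    moreover have "c q \<le> b"
    proof (rule c(2))
      fix x assume x: "V {x..} \<le> q"
      show "x \<le> b"
      proof (rule ccontr)
        assume "\<not> x \<le> b"
        then have "V {b<..} \<le> V {x..}"
          by (intro Vmono) auto
        then show False
          using x q(3) by simp
      qed
    qed
    ultimately have "c q \<in> J"
      using abJ by auto
    then show False
      using J(2) q(1) by blast
  qed
  then show ?thesis
    unfolding carried_by_def by (intro exI[of _ "c ` \<rat>"]) (simp add: countable_rat)
qed

section \<open>Nontriviality\<close>

lemma bump_function:
  fixes d :: "'l::linorder_topology"
  assumes cpt: "compact (UNIV :: 'l set)" and J: "open J" "d \<in> J"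
  obtains f :: "'l \<Rightarrow>\<^sub>C real" where "apply_bcontfun f d = 1" "\<And>x. x \<notin> J \<Longrightarrow> apply_bcontfun f x = 0"
proof -
  have "normal_space (euclidean :: 'l topology)"
    using cpt by (intro compact_Hausdorff_or_regular_imp_normal_space disjI1)
      (simp_all add: compact_space_def Hausdorff_space_def disjnt_def, metis hausdorff)
  then obtain \<phi> where \<phi>: "continuous_map euclidean euclideanreal \<phi>" "\<phi> ` {d} \<subseteq> {1}" "\<phi> ` (- J) \<subseteq> {0 :: real}"
    by (rule Urysohn_lemma_alt[of _ "{d}" "- J" 1 0]) (use J in \<open>auto simp: disjnt_def\<close>)
  have "continuous_on UNIV \<phi>"
    using \<phi>(1) by simp
  moreover from this have "bounded (range \<phi>)"
    using cpt by (intro compact_imp_bounded compact_continuous_image)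
  ultimately have "\<phi> \<in> bcontfun"
    by (simp add: bcontfun_def)
  then have "apply_bcontfun (Bcontfun \<phi>) = \<phi>"
    by (rule Bcontfun_inverse)
  then show thesis
    using \<phi> by (intro that[of "Bcontfun \<phi>"]) auto
qed

text \<open>
  Given a retraction \<open>r\<close> onto \<open>c\<^sub>0\<close>, the difference \<open>u - r (u, f)\<close> depends on \<open>f\<close> only. As a function
  of \<open>f\<close> it is the bounded lifting, and its coordinates are the functionals \<open>\<mu> n\<close>.
\<close>

lemma pullback_space_nontrivial:
  fixes A :: "'l::linorder_topology \<Rightarrow> nat set"
  assumes cpt: "compact (UNIV :: 'l set)" and A: "almost_mono A"
    and D: "\<And>d. d \<in> D \<Longrightarrow> cut_filter A d \<noteq> bot"
    and nonsep: "\<And>E. countable E \<Longrightarrow> \<not> D \<subseteq> closure E"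
  shows "\<not> trivial_twisted_sum c0 norm (pullback_space A) norm (\<lambda>u. (u, 0))"
proof
  let ?X = "pullback_space A"
  assume "trivial_twisted_sum c0 norm ?X norm (\<lambda>u. (u, 0))"
  then obtain r where r: "bounded_linear_on ?X norm c0 norm r" "\<forall>u\<in>c0. r (u, 0) = u"
    unfolding trivial_twisted_sum_def by blast
  then have r_c0: "r p \<in> c0" if "p \<in> ?X" for p
    using that unfolding bounded_linear_on_def by blast
  have r_add: "r (p + p') = r p + r p'" if "p \<in> ?X" "p' \<in> ?X" for p p'
    using r(1) that unfolding bounded_linear_on_def by blast
  have r_scale: "r (c *\<^sub>R p) = c *\<^sub>R r p" if "p \<in> ?X" for p c
    using r(1) that unfolding bounded_linear_on_def by blast
  obtain K where r_bound: "\<And>p. p \<in> ?X \<Longrightarrow> norm (r p) \<le> K * norm p"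
    using r(1) unfolding bounded_linear_on_def by blast
  have X: "subspace ?X"
    using banach_on_pullback_space[of A] by (simp add: banach_on_def)
  define h where "h = (\<lambda>p. fst p - r p)"
  have h_add: "h (p + p') = h p + h p'" if "p \<in> ?X" "p' \<in> ?X" for p p'
    using r_add[OF that] by (simp add: h_def)
  have h_scale: "h (c *\<^sub>R p) = c *\<^sub>R h p" if "p \<in> ?X" for p c
    using r_scale[OF that] by (simp add: h_def scaleR_diff_right)
  have h_eq: "h p = h p'" if p: "p \<in> ?X" "p' \<in> ?X" "snd p = snd p'" for p p'
  proof -
    have eq: "p - p' = (fst p - fst p', 0)"
      using p(3) by (simp add: prod_eq_iff)
    then have mem: "(fst p - fst p', 0) \<in> ?X"
      using subspace_diff[OF X p(1,2)] by simp
    then have "h (fst p - fst p', 0) = 0"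
      using r(2) pullback_space_kernel[OF cpt A] by (simp add: h_def)
    moreover have "h p = h (fst p - fst p', 0) + h p'"
      using h_add[OF mem p(2)] eq by (metis diff_add_cancel)
    ultimately show ?thesis
      by simp
  qed
  obtain U where U: "\<And>f. (U f, f) \<in> ?X" "\<And>f. norm (U f) \<le> norm f"
    using pullback_space_surj[OF cpt A] by metis
  define \<mu> where "\<mu> = (\<lambda>n f. apply_bcontfun (h (U f, f)) n)"
  have "bounded_linear (\<mu> n)" for n
  proof (rule bounded_linear_intro)
    fix f g :: "'l \<Rightarrow>\<^sub>C real" and c :: real
    have "h (U (f + g), f + g) = h ((U f, f) + (U g, g))"
      by (rule h_eq) (use U(1) subspace_add[OF X U(1) U(1)] in auto)
    then show "\<mu> n (f + g) = \<mu> n f + \<mu> n g"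
      using h_add[OF U(1) U(1)] by (simp add: \<mu>_def)
    have "h (U (c *\<^sub>R f), c *\<^sub>R f) = h (c *\<^sub>R (U f, f))"
      by (rule h_eq) (use U(1) subspace_scale[OF X U(1)] in auto)
    then show "\<mu> n (c *\<^sub>R f) = c *\<^sub>R \<mu> n f"
      using h_scale[OF U(1)] by (simp add: \<mu>_def)
    have "norm (U f, f) \<le> 2 * norm f"
      using norm_Pair_le[of "U f" f] U(2)[of f] by simp
    then have "\<bar>K\<bar> * norm (U f, f) \<le> \<bar>K\<bar> * (2 * norm f)"
      by (rule mult_left_mono) simp
    moreover have "norm (r (U f, f)) \<le> \<bar>K\<bar> * norm (U f, f)"
      using r_bound[OF U(1)] by (rule order_trans) (simp add: mult_right_mono)
    moreover have "norm (\<mu> n f) \<le> norm (U f) + norm (r (U f, f))"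
      using norm_bounded[of "h (U f, f)" n] norm_triangle_ineq4[of "U f" "r (U f, f)"]
      by (simp add: \<mu>_def h_def)
    ultimately show "norm (\<mu> n f) \<le> norm f * (1 + 2 * \<bar>K\<bar>)"
      using U(2)[of f] by (simp add: algebra_simps)
  qed
  then have "\<exists>E. countable E \<and> carried_by E (\<mu> n)" for n
    by (rule functional_countably_carried[OF cpt])
  then obtain E where E: "\<And>n. countable (E n)" "\<And>n. carried_by (E n) (\<mu> n)"
    by metis
  have "countable (\<Union>n. E n)"
    using E(1) by blast
  then obtain d where d: "d \<in> D" "d \<in> - closure (\<Union>n. E n)"
    using nonsep by blast
  obtain J where J: "open J" "d \<in> J" "J \<subseteq> - closure (\<Union>n. E n)" "\<forall>a\<in>J. \<forall>b\<in>J. {a..b} \<subseteq> J"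
    using interval_neighbourhood[OF open_Compl[OF closed_closure] d(2)] by metis
  obtain f :: "'l \<Rightarrow>\<^sub>C real" where f: "apply_bcontfun f d = 1" "\<And>x. x \<notin> J \<Longrightarrow> apply_bcontfun f x = 0"
    using bump_function[OF cpt J(1,2)] by metis
  have "J \<inter> E n = {}" for n
    using J(3) closure_subset[of "\<Union>n. E n"] by blast
  then have \<mu>0: "\<mu> n f = 0" for n
    using E(2)[of n, unfolded carried_by_def, THEN spec, THEN spec, THEN mp, THEN mp, THEN mp, OF J(4)] f(2)
    by blast
  have "(apply_bcontfun (U f) \<longlongrightarrow> 1) (cut_filter A d)"
  proof -
    have "(apply_bcontfun (U f) \<longlongrightarrow> apply_bcontfun f d) (cut_filter A d)"
      using U(1)[of f] by (simp add: pullback_space_def)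
    then show ?thesis
      by (simp only: f(1))
  qed
  moreover have "(apply_bcontfun (r (U f, f)) \<longlongrightarrow> 0) (cut_filter A d)"
  proof (rule tendsto_mono[OF cut_filter_le_sequentially])
    show "apply_bcontfun (r (U f, f)) \<longlonglongrightarrow> 0"
      using r_c0[OF U(1)[of f]] by (simp add: c0_def)
  qed
  ultimately have "((\<lambda>n. apply_bcontfun (U f) n - apply_bcontfun (r (U f, f)) n) \<longlongrightarrow> 1 - 0) (cut_filter A d)"
    by (rule tendsto_diff)
  then have "((\<lambda>n. \<mu> n f) \<longlongrightarrow> 1 - 0) (cut_filter A d)"
    by (simp add: \<mu>_def h_def)
  then have "((\<lambda>n. 0 :: real) \<longlongrightarrow> 1) (cut_filter A d)"
    using \<mu>0 by simp
  then show False
    using D[OF d(1)] by (simp add: tendsto_const_iff)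
qed

theorem theorem8p1:
  assumes "continuum_hypothesis"
    and "compact (UNIV :: 'l::linorder_topology set)"
    and "\<not> separable_space (euclidean :: 'l topology)"
  shows "\<exists>(X :: ((nat \<Rightarrow>\<^sub>C real) \<times> ('l \<Rightarrow>\<^sub>C real)) set) N i q.
           twisted_sum c0 norm (UNIV :: ('l \<Rightarrow>\<^sub>C real) set) norm X N i q \<and>
           \<not> trivial_twisted_sum c0 norm X N i"
proof -
  obtain R :: "real rel" where R: "wf R" "total R" "\<And>a. countable {b. (b, a) \<in> R}"
    using CH_well_order[OF assms(1)] by metis
  obtain x :: "real \<Rightarrow> 'l" where x: "\<And>a. x a \<notin> closure (x ` {b. (b, a) \<in> R})"
    and cof: "\<And>p. range x \<inter> {..p} = range x \<or>
          (\<exists>C\<subseteq>range x \<inter> {..p}. countable C \<and> (\<forall>d\<in>range x \<inter> {..p}. \<exists>c\<in>C. d \<le> c))"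
    using left_separated_sequence[OF R assms(3)] by metis
  obtain A :: "'l \<Rightarrow> nat set" where A: "almost_mono A" "\<And>p. infinite (A p)"
    "\<And>p d. d \<in> range x \<Longrightarrow> p < d \<Longrightarrow> infinite (A d - A p)"
    using almost_mono_family[OF R cuts_lepoll_real[OF cof]] by metis
  have nonbot: "cut_filter A d \<noteq> bot" if "d \<in> range x" for d
    using A that by (intro cut_filter_nontrivial) auto
  have "\<not> range x \<subseteq> closure E" if E: "countable E" for E
  proof
    assume "range x \<subseteq> closure E"
    from hereditarily_separable[OF E this]
    obtain C where C: "C \<subseteq> range x" "countable C" "range x \<subseteq> closure C"
      by (elim exE conjE)
    then obtain B where B: "countable B" "C = x ` B"
      using countable_subset_image[of C x UNIV] by auto
    obtain a where "\<forall>b\<in>B. (b, a) \<in> R"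
      using countable_imp_bounded[OF R(2,3) B(1)] by blast
    then have "C \<subseteq> x ` {b. (b, a) \<in> R}"
      using B by blast
    then have "x a \<in> closure (x ` {b. (b, a) \<in> R})"
      using C(3) closure_mono by blast
    then show False
      using x by blast
  qed
  then have "\<not> trivial_twisted_sum c0 norm (pullback_space A) norm (\<lambda>u. (u, 0))"
    by (intro pullback_space_nontrivial[OF assms(2) A(1) nonbot]) auto
  then show ?thesis
    using twisted_sum_pullback_space[OF assms(2) A(1)] by blast
qed

end
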